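(* The operator norm ball $\{X\in\mathbb{R}^{n\times n}:\sigma_1(X)\le1\}$ is equal to $\mathrm{conv}(O(n))$, the tautological orbitope of the orthogonal group $O(n)$. The polar body (coorbitope) $\mathrm{conv}(O(n))^\circ$ is the nuclear norm ball $\{X\in\mathbb{R}^{n\times n}:\sigma_1(X)+\cdots+\sigma_n(X)\le1\}$. Both of these convex bodies are spectrahedra: a matrix $X\in\mathbb{R}^{n\times n}$ lies in $\mathrm{conv}(O(n))$ if and only if $$\begin{pmatrix}\mathrm{Id}_n & X \\ X^T & \mathrm{Id}_n\end{pmatrix}\succeq0,$$ and $X$ lies in $\mathrm{conv}(O(n))^\circ$ if and only if $$\mathrm{Id}_{\binom{2n}{n}}-\mathcal{L}_n(S(X))\succeq0 .$$
   Context: $\sigma_1(X)\ge\cdots\ge\sigma_n(X)\ge0$ are the singular values of $X$. $\mathrm{conv}$ is the convex hull, taken in $\mathbb{R}^{n\times n}$. The polar body is $K^\circ=\{Y\in\mathbb{R}^{n\times n}:\langle X,Y\rangle\le1\ \text{for all }X\in K\}$ with respect to the standard inner product $\langle X,Y\rangle=\mathrm{Tr}(X^TY)$. A spectrahedron is a set of the form $\{x\in\mathbb{R}^N: A_0+x_1A_1+\cdots+x_NA_N\succeq0\}$ with $A_i$ real symmetric matrices, where $\succeq0$ denotes positive semidefiniteness. $S(X)$ is the symmetric $2n\times2n$ matrix $\begin{pmatrix}0 & X \\ X^T & 0\end{pmatrix}$. For an $m\times m$ matrix $B$, the additive compound matrix $\mathcal{L}_r(B)$ is the $\binom mr\times\binom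 mr$ matrix representing, in the standard basis of $\wedge_r\mathbb{R}^m$, the linear map $v_1\wedge\cdots\wedge v_r\mapsto\sum_{j=1}^r v_1\wedge\cdots\wedge v_{j-1}\wedge(Bv_j)\wedge v_{j+1}\wedge\cdots\wedge v_r$. *)

theory Defs
  imports "HOL-Analysis.Analysis"
begin

section \<open>Singular values\<close>

definition charpoly_mat :: "real^'n^'n \<Rightarrow> real poly" where
  "charpoly_mat A = det (\<chi> i j. (if i = j then [:0, 1:] else 0) - [:A $ i $ j:])"

text \<open>The square roots of the eigenvalues of \<open>X\<^sup>T X\<close>, with algebraic multiplicity, in
  decreasing order. As \<open>X\<^sup>T X\<close> is positive semidefinite, its characteristic polynomial splits over
  the reals and has nonnegative roots, so this list has length \<open>n\<close>.\<close>

definition singular_values :: "real^'n^'n \<Rightarrow> real list" where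
  "singular_values X =
     rev (sorted_list_of_multiset
       (image_mset sqrt (proots (charpoly_mat (transpose X ** X)))))"

text \<open>Numbered from 1 to \<open>n\<close>.\<close>

definition singular_value :: "nat \<Rightarrow> real^'n^'n \<Rightarrow> real" where
  "singular_value i X = singular_values X ! (i - 1)"


section \<open>Convex bodies and polarity\<close>

definition convex_body :: "'a::euclidean_space set \<Rightarrow> bool" where
  "convex_body K \<longleftrightarrow> convex K \<and> compact K \<and> interior K \<noteq> {}"

definition polar_body :: "(real^'n^'n) set \<Rightarrow> (real^'n^'n) set" where
  "polar_body K = {Y. \<forall>X\<in>K. trace (transpose X ** Y) \<le> 1}"

definition orthogonal_group :: "(real^'n^'n) set" where
  "orthogonal_group = {Q. orthogonal_matrix Q}"


section \<open>Positive semidefiniteness and spectrahedra\<close>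

text \<open>Matrices whose index set is not a type, such as the set of all \<open>r\<close>-element subsets of a
  type, are functions of two indices of which only the values on the index set \<open>S\<close> matter.\<close>

definition symmetric_on :: "'i set \<Rightarrow> ('i \<Rightarrow> 'i \<Rightarrow> real) \<Rightarrow> bool" where
  "symmetric_on S M \<longleftrightarrow> (\<forall>i\<in>S. \<forall>j\<in>S. M i j = M j i)"

definition psd_on :: "'i set \<Rightarrow> ('i \<Rightarrow> 'i \<Rightarrow> real) \<Rightarrow> bool" where
  "psd_on S M \<longleftrightarrow> symmetric_on S M \<and> (\<forall>x. 0 \<le> (\<Sum>i\<in>S. \<Sum>j\<in>S. x i * M i j * x j))"

definition psd :: "real^'m^'m \<Rightarrow> bool" where
  "psd A \<longleftrightarrow> psd_on UNIV (\<lambda>i j. A $ i $ j)"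

text \<open>The coordinates \<open>x\<^sub>1, \<dots>, x\<^sub>N\<close> are those with respect to \<open>Basis\<close>; for \<open>n \<times> n\<close> matrices they
  are the \<open>n\<^sup>2\<close> matrix entries. The coefficient matrices have an arbitrary size \<open>k\<close>.\<close>

definition spectrahedron :: "'a::euclidean_space set \<Rightarrow> bool" where
  "spectrahedron K \<longleftrightarrow>
     (\<exists>(k::nat) (A0 :: nat \<Rightarrow> nat \<Rightarrow> real) (A :: 'a \<Rightarrow> nat \<Rightarrow> nat \<Rightarrow> real).
        symmetric_on {..<k} A0 \<and> (\<forall>b\<in>Basis. symmetric_on {..<k} (A b)) \<and>
        K = {x. psd_on {..<k} (\<lambda>i j. A0 i j + (\<Sum>b\<in>Basis. (x \<bullet> b) * A b i j))})"


section \<open>Block matrices\<close>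

definition block_matrix ::
    "real^'n^'m \<Rightarrow> real^'q^'m \<Rightarrow> real^'n^'p \<Rightarrow> real^'q^'p \<Rightarrow> real^('n + 'q)^('m + 'p)" where
  "block_matrix A B C D =
     (\<chi> a b. case a of
        Inl i \<Rightarrow> (case b of Inl j \<Rightarrow> A $ i $ j | Inr j \<Rightarrow> B $ i $ j)
      | Inr i \<Rightarrow> (case b of Inl j \<Rightarrow> C $ i $ j | Inr j \<Rightarrow> D $ i $ j))"

definition sym_dilation :: "real^'n^'n \<Rightarrow> real^('n + 'n)^('n + 'n)" where
  "sym_dilation X = block_matrix 0 X (transpose X) 0"

text \<open>The indices of the first block precede those of the second one.\<close>

instantiation sum :: (linorder, linorder) linorder
begin

definition less_eq_sum :: "'a + 'b \<Rightarrow> 'a + 'b \<Rightarrow> bool" where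
  "less_eq_sum a b \<longleftrightarrow>
     (case a of
        Inl i \<Rightarrow> (case b of Inl j \<Rightarrow> i \<le> j | Inr j \<Rightarrow> True)
      | Inr i \<Rightarrow> (case b of Inl j \<Rightarrow> False | Inr j \<Rightarrow> i \<le> j))"

definition less_sum :: "'a + 'b \<Rightarrow> 'a + 'b \<Rightarrow> bool" where
  "less_sum a b \<longleftrightarrow> a \<le> b \<and> \<not> b \<le> a"

instance
  by standard (auto simp: less_eq_sum_def less_sum_def split: sum.splits)

end


section \<open>Additive compound matrices\<close>

text \<open>The standard basis of \<open>\<Lambda>\<^sub>r \<real>\<^sup>m\<close> consists of the
  \<open>e\<^sub>J = e\<^bsub>j\<^sub>1\<^esub> \<and> \<dots> \<and> e\<^bsub>j\<^sub>r\<^esub>\<close> for the \<open>r\<close>-element sets \<open>J = {j\<^sub>1 < \<dots> < j\<^sub>r}\<close>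
  of indices. The coordinate of \<open>v\<^sub>1 \<and> \<dots> \<and> v\<^sub>r\<close> at \<open>e\<^sub>I\<close> is the minor formed by the rows in \<open>I\<close>
  of the matrix with columns \<open>v\<^sub>1, \<dots>, v\<^sub>r\<close>. Vectors are numbered from 0 here.\<close>

definition index_sets :: "nat \<Rightarrow> 'm::finite set set" where
  "index_sets r = {I. card I = r}"

definition wedge_coord ::
    "nat \<Rightarrow> (nat \<Rightarrow> real^'m::{finite,linorder}) \<Rightarrow> 'm set \<Rightarrow> real" where
  "wedge_coord r v I =
     (\<Sum>p | p permutes {..<r}.
        of_int (sign p) * (\<Prod>k<r. v k $ (sorted_list_of_set I ! p k)))"

definition basis_family :: "'m set \<Rightarrow> nat \<Rightarrow> real^'m::{finite,linorder}" where
  "basis_family J k = axis (sorted_list_of_set J ! k) 1"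

text \<open>The coordinates of the image of \<open>v\<^sub>1 \<and> \<dots> \<and> v\<^sub>r\<close> under the derivation induced by \<open>B\<close>.\<close>

definition derivation_coord ::
    "nat \<Rightarrow> real^'m::{finite,linorder}^'m::{finite,linorder} \<Rightarrow> (nat \<Rightarrow> real^'m::{finite,linorder}) \<Rightarrow> 'm set \<Rightarrow> real" where
  "derivation_coord r B v I = (\<Sum>k<r. wedge_coord r (v(k := B *v v k)) I)"

text \<open>Column \<open>J\<close> of the matrix consists of the coordinates of the image of \<open>e\<^sub>J\<close>.\<close>

definition additive_compound ::
    "nat \<Rightarrow> real^'m::{finite,linorder}^'m::{finite,linorder} \<Rightarrow> 'm set \<Rightarrow> 'm set \<Rightarrow> real" where
  "additive_compound r B I J = derivation_coord r B (basis_family J) I"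

lemma card_index_sets: "card (index_sets r :: 'm::finite set set) = CARD('m) choose r"
  using n_subsets[of "UNIV :: 'm set" r] by (simp add: index_sets_def)


section \<open>Compound matrices represent the induced derivation\<close>

lemma wedge_coord_cong:
  "(\<And>k. k < r \<Longrightarrow> v k = w k) \<Longrightarrow> wedge_coord r v I = wedge_coord r w I"
  by (simp add: wedge_coord_def)

lemma wedge_coord_permute:
  assumes q: "q permutes {..<r}"
  shows "wedge_coord r (\<lambda>k. v (q k)) I = of_int (sign q) * wedge_coord r v I"
proof -
  let ?s = "\<lambda>k. sorted_list_of_set I ! k"
  let ?P = "{p. p permutes {..<r}}"
  have perm: "permutation p" if "p permutes {..<r}" for p :: "nat \<Rightarrow> nat"
    using that permutation_permutes by blast
  have sgn: "sign (p \<circ> q) = sign q * sign p" if "p \<in> ?P" for p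
    using that q perm by (simp add: sign_compose)
  have prd: "(\<Prod>k<r. v (q k) $ ?s (p (q k))) = (\<Prod>k<r. v k $ ?s (p k))" for p
    using prod.permute[OF q, of "\<lambda>k. v k $ ?s (p k)"] by (simp add: o_def)
  have "wedge_coord r (\<lambda>k. v (q k)) I =
      (\<Sum>p\<in>?P. of_int (sign (p \<circ> q)) * (\<Prod>k<r. v (q k) $ ?s ((p \<circ> q) k)))"
    unfolding wedge_coord_def by (rule sum_permutations_compose_right[OF q])
  also have "\<dots> = of_int (sign q) * wedge_coord r v I"
    unfolding wedge_coord_def sum_distrib_left
    by (rule sum.cong) (simp_all add: sgn prd mult.assoc)
  finally show ?thesis .
qed

lemma derivation_coord_permute:
  assumes q: "q permutes {..<r}"
  shows "derivation_coord r B (\<lambda>k. v (q k)) I = of_int (sign q) * derivation_coord r B v I"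
proof -
  have *: "(\<lambda>l. v (q l))(k := B *v v (q k)) = (\<lambda>l. (v(q k := B *v v (q k))) (q l))" for k
    using permutes_inj[OF q] by (auto simp: fun_eq_iff inj_eq)
  have "derivation_coord r B (\<lambda>k. v (q k)) I =
      of_int (sign q) * (\<Sum>k<r. wedge_coord r (v(q k := B *v v (q k))) I)"
    unfolding derivation_coord_def * wedge_coord_permute[OF q] by (simp add: sum_distrib_left)
  also have "(\<Sum>k<r. wedge_coord r (v(q k := B *v v (q k))) I) = derivation_coord r B v I"
    unfolding derivation_coord_def
    using sum.permute[OF q, of "\<lambda>k. wedge_coord r (v(k := B *v v k)) I"] by (simp add: o_def)
  finally show ?thesis .
qed

lemma derivation_coord_eq_0:
  assumes "a < r" "b < r" "a \<noteq> b" "v a = v b"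
  shows "derivation_coord r B v I = 0"
proof -
  let ?q = "Transposition.transpose a b"
  have "?q permutes {..<r}" using assms by (intro permutes_swap_id) auto
  moreover have "(\<lambda>k. v (?q k)) = v" using assms by (auto simp: fun_eq_iff Transposition.transpose_def)
  ultimately have "derivation_coord r B v I = - derivation_coord r B v I"
    using derivation_coord_permute[of ?q r B v I] assms by (simp add: sign_swap_id)
  then show ?thesis by simp
qed

lemma derivation_coord_expand:
  "derivation_coord r B v I =
    (\<Sum>f\<in>{..<r} \<rightarrow>\<^sub>E UNIV. (\<Prod>k<r. v k $ f k) * derivation_coord r B (\<lambda>k. axis (f k) 1) I)"
proof -
  let ?s = "\<lambda>k. sorted_list_of_set I ! k"
  let ?P = "{p. p permutes {..<r}}" and ?F = "{..<r} \<rightarrow>\<^sub>E (UNIV :: 'a set)"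
  have ax: "x $ j = (\<Sum>i\<in>UNIV. x $ i * axis i 1 $ j)" for x :: "real^'a::{finite,linorder}" and j
    by (simp add: axis_def if_distrib[of "(*) _"] sum.delta' cong: if_cong)
  have Bx: "(B *v x) $ j = (\<Sum>i\<in>UNIV. x $ i * (B *v axis i 1) $ j)" for x j
    by (simp only: matrix_vector_mult_basis column_def) (simp add: matrix_vector_mult_def mult.commute)
  have upd: "(v(k := B *v v k)) l $ j =
      (\<Sum>i\<in>UNIV. v l $ i * (if l = k then B *v axis i 1 else axis i 1) $ j)" for k l j
    using ax[of "v l" j] Bx[of "v k" j] by simp
  have "(\<Prod>l<r. (v(k := B *v v k)) l $ ?s (p l)) =
      (\<Sum>f\<in>?F. (\<Prod>l<r. v l $ f l) *
        (\<Prod>l<r. ((\<lambda>l. axis (f l) 1)(k := B *v axis (f k) 1)) l $ ?s (p l)))" for k p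
  proof -
    let ?c = "\<lambda>l i. (if l = k then B *v axis i 1 else axis i 1) $ ?s (p l)"
    have "(\<Prod>l<r. (v(k := B *v v k)) l $ ?s (p l)) = (\<Prod>l<r. \<Sum>i\<in>UNIV. v l $ i * ?c l i)"
      by (rule prod.cong[OF refl upd])
    also have "\<dots> = (\<Sum>f\<in>?F. \<Prod>l<r. v l $ f l * ?c l (f l))"
      by (rule prod_sum_PiE) simp_all
    also have "\<dots> = (\<Sum>f\<in>?F. (\<Prod>l<r. v l $ f l) *
        (\<Prod>l<r. ((\<lambda>l. axis (f l) 1)(k := B *v axis (f k) 1)) l $ ?s (p l)))"
      unfolding prod.distrib by (intro sum.cong prod.cong arg_cong2[of _ _ _ _ "(*)"] refl) simp
    finally show ?thesis .
  qed
  then have "wedge_coord r (v(k := B *v v k)) I =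
      (\<Sum>f\<in>?F. (\<Prod>l<r. v l $ f l) * wedge_coord r ((\<lambda>l. axis (f l) 1)(k := B *v axis (f k) 1)) I)" for k
    unfolding wedge_coord_def
    by (simp only: sum_distrib_left) (subst sum.swap, simp add: mult_ac)
  then show ?thesis
    unfolding derivation_coord_def by (simp only: sum_distrib_left) (subst sum.swap, simp)
qed

lemma injective_family_bij:
  "bij_betw (\<lambda>(J, p). \<lambda>k\<in>{..<r}. sorted_list_of_set J ! p k)
     (index_sets r \<times> {p. p permutes {..<r}})
     {f \<in> {..<r} \<rightarrow>\<^sub>E (UNIV :: 'm::{finite,linorder} set). inj_on f {..<r}}"
  (is "bij_betw ?h ?A ?F")
proof (rule bij_betwI')
  have len: "length (sorted_list_of_set J) = r" "distinct (sorted_list_of_set J)"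
    "set (sorted_list_of_set J) = J" if "J \<in> index_sets r" for J :: "'m set"
    using that by (auto simp: index_sets_def)
  have img: "?h (J, p) ` {..<r} = J" if "J \<in> index_sets r" "p permutes {..<r}" for J p
  proof -
    have "?h (J, p) ` {..<r} = (!) (sorted_list_of_set J) ` p ` {..<r}"
      by (auto simp: image_image)
    also have "\<dots> = J"
      using bij_betw_nth[OF len(2)[OF that(1)], of "{..<r}" J] len[OF that(1)]
      unfolding permutes_image[OF that(2)] by (simp add: bij_betw_def)
    finally show ?thesis .
  qed
  show "(?h x = ?h y) = (x = y)" if "x \<in> ?A" "y \<in> ?A" for x y
  proof
    assume eq: "?h x = ?h y"
    obtain J p K q where xy: "x = (J, p)" "y = (K, q)" by fastforce
    have JK: "J = K" using img[of J p] img[of K q] that eq unfolding xy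
      by (metis (no_types, lifting) mem_Collect_eq mem_Sigma_iff)
    have "p k = q k" for k
    proof (cases "k < r")
      case True
      have "sorted_list_of_set J ! p k = sorted_list_of_set J ! q k"
        using fun_cong[OF eq, of k] True xy JK by simp
      moreover have "p k < r" "q k < r"
        using True that xy permutes_in_image[of _ "{..<r}"] by (metis lessThan_iff mem_Collect_eq mem_Sigma_iff)+
      ultimately show ?thesis
        using len[of J] that xy by (simp add: nth_eq_iff_index_eq)
    next
      case False
      then show ?thesis using that xy by (auto simp: permutes_def)
    qed
    then show "x = y" using JK xy by auto
  qed simp
  show "?h x \<in> ?F" if xA: "x \<in> ?A" for x
  proof -
    obtain J p where x: "x = (J, p)" "J \<in> index_sets r" "p permutes {..<r}" using xA by auto
    have "card (?h x ` {..<r}) = card {..<r}"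
      using img[OF x(2,3)] x by (simp add: index_sets_def)
    then have "inj_on (?h x) {..<r}" by (intro eq_card_imp_inj_on) auto
    then show ?thesis using x by auto
  qed
  show "\<exists>x\<in>?A. f = ?h x" if f: "f \<in> ?F" for f
  proof -
    define J where "J = f ` {..<r}"
    let ?s = "sorted_list_of_set J"
    have J: "J \<in> index_sets r" using f by (auto simp: J_def index_sets_def card_image)
    note l = len[OF J]
    have bs: "bij_betw ((!) ?s) {..<r} J"
      using bij_betw_nth[OF l(2), of "{..<r}" J] l by simp
    have bf: "bij_betw f {..<r} J" using f by (auto simp: J_def bij_betw_def)
    define p where "p k = (if k < r then inv_into {..<r} ((!) ?s) (f k) else k)" for k
    have "bij_betw (inv_into {..<r} ((!) ?s) \<circ> f) {..<r} {..<r}"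
      using bij_betw_trans[OF bf bij_betw_inv_into[OF bs]] .
    then have "bij_betw p {..<r} {..<r}"
      by (rule bij_betw_cong[THEN iffD1, rotated]) (simp add: p_def)
    then have p: "p permutes {..<r}" by (rule bij_imp_permutes) (simp add: p_def)
    have "f k = ?h (J, p) k" for k
    proof (cases "k < r")
      case True
      then have "f k \<in> (!) ?s ` {..<r}" using bs by (auto simp: J_def bij_betw_def)
      then show ?thesis using True by (simp add: p_def f_inv_into_f)
    next
      case False
      then show ?thesis using f by (auto simp: PiE_def extensional_def)
    qed
    then show ?thesis using J p by (intro bexI[of _ "(J, p)"]) auto
  qed
qed

text \<open>The matrix represents the linear map: applied to the coordinates of \<open>v\<^sub>1 \<and> \<dots> \<and> v\<^sub>r\<close>, for
  arbitrary \<open>v\<^sub>1, \<dots>, v\<^sub>r\<close>, it gives the coordinates of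
  \<open>\<Sum>\<^sub>k v\<^sub>1 \<and> \<dots> \<and> B v\<^sub>k \<and> \<dots> \<and> v\<^sub>r\<close>.\<close>

lemma derivation_coord_additive_compound:
  "derivation_coord r B v I =
    (\<Sum>J\<in>index_sets r. additive_compound r B I J * wedge_coord r v J)"
proof -
  let ?F = "{..<r} \<rightarrow>\<^sub>E (UNIV :: 'a set)" and ?P = "{p. p permutes {..<r}}"
  let ?D = "\<lambda>f. derivation_coord r B (\<lambda>k. axis (f k) 1) I"
  let ?G = "{f \<in> ?F. inj_on f {..<r}}"
  let ?h = "\<lambda>(J, p). \<lambda>k\<in>{..<r}. sorted_list_of_set J ! p k"
  have coord_eq: "derivation_coord r B w I = derivation_coord r B w' I"
    if "\<And>k. k < r \<Longrightarrow> w k = w' k" for w w'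
    unfolding derivation_coord_def using that by (intro sum.cong wedge_coord_cong) auto
  have fin: "finite ?F" by (intro finite_PiE) auto
  have D: "?D (?h (J, p)) = of_int (sign p) * additive_compound r B I J" if "p \<in> ?P" for J p
  proof -
    have "?D (?h (J, p)) = derivation_coord r B (\<lambda>k. basis_family J (p k)) I"
      by (rule coord_eq) (simp add: basis_family_def)
    then show ?thesis
      using that derivation_coord_permute[of p r B "basis_family J" I]
      by (simp add: additive_compound_def)
  qed
  have "derivation_coord r B v I = (\<Sum>f\<in>?F. (\<Prod>k<r. v k $ f k) * ?D f)"
    by (rule derivation_coord_expand)
  also have "\<dots> = (\<Sum>f\<in>?G. (\<Prod>k<r. v k $ f k) * ?D f)"
  proof (rule sum.mono_neutral_right[OF fin])
    show "\<forall>f\<in>?F - ?G. (\<Prod>k<r. v k $ f k) * ?D f = 0"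
    proof
      fix f assume "f \<in> ?F - ?G"
      then obtain a b where "a < r" "b < r" "a \<noteq> b" "f a = f b" by (auto simp: inj_on_def)
      then have "?D f = 0" by (intro derivation_coord_eq_0[of a r b]) auto
      then show "(\<Prod>k<r. v k $ f k) * ?D f = 0" by simp
    qed
  qed auto
  also have "\<dots> = (\<Sum>x\<in>index_sets r \<times> ?P. (\<Prod>k<r. v k $ ?h x k) * ?D (?h x))"
    by (rule sum.reindex_bij_betw[OF injective_family_bij, symmetric])
  also have "\<dots> = (\<Sum>J\<in>index_sets r. \<Sum>p\<in>?P. (\<Prod>k<r. v k $ ?h (J, p) k) * ?D (?h (J, p)))"
    by (simp only: sum.cartesian_product) (rule sum.cong, auto)
  also have "\<dots> = (\<Sum>J\<in>index_sets r. additive_compound r B I J * wedge_coord r v J)"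
    unfolding wedge_coord_def sum_distrib_left
    by (intro sum.cong refl) (subst D, simp_all)
  finally show ?thesis .
qed

text \<open>The family \<open>e\<^bsub>j\<^sub>1\<^esub>, \<dots>, e\<^bsub>j\<^sub>r\<^esub>\<close> has the coordinates of the standard basis vector \<open>e\<^sub>J\<close>.\<close>

lemma wedge_coord_basis_family:
  assumes I: "I \<in> index_sets r" and J: "J \<in> index_sets r"
  shows "wedge_coord r (basis_family J) I = (if I = J then 1 else 0)"
proof -
  let ?P = "{p. p permutes {..<r}}"
  let ?s = "sorted_list_of_set I" and ?t = "sorted_list_of_set J"
  have len: "length (sorted_list_of_set K) = r" "distinct (sorted_list_of_set K)"
    "set (sorted_list_of_set K) = K" if "K \<in> index_sets r" for K :: "'a set"
    using that by (auto simp: index_sets_def)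
  have eqf: "I = J \<and> p = id" if p: "p permutes {..<r}" and e: "\<forall>k<r. ?t ! k = ?s ! p k" for p
  proof -
    have inj: "inj_on (\<lambda>(J, p). \<lambda>k\<in>{..<r}. sorted_list_of_set J ! p k) (index_sets r \<times> ?P)"
      by (rule bij_betw_imp_inj_on[OF injective_family_bij])
    have "(J, id) = (I, p)"
      by (rule inj_onD[OF inj]) (use e p I J in \<open>auto simp: permutes_id fun_eq_iff restrict_def\<close>)
    then show ?thesis by auto
  qed
  have entry: "(\<Prod>k<r. basis_family J k $ (?s ! p k)) = (if I = J \<and> p = id then 1 else 0)"
    if "p \<in> ?P" for p
  proof (cases "\<forall>k<r. ?t ! k = ?s ! p k")
    case True
    then show ?thesis using eqf[of p] that by (auto simp: basis_family_def axis_def intro!: prod.neutral)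
  next
    case False
    then obtain k where "k < r" "?t ! k \<noteq> ?s ! p k" by blast
    then have "(\<Prod>k<r. basis_family J k $ (?s ! p k)) = 0"
      by (intro prod_zero) (auto simp: basis_family_def axis_def intro!: bexI[of _ k])
    then show ?thesis using False by auto
  qed
  have "wedge_coord r (basis_family J) I = (\<Sum>p\<in>?P. if p = id then (if I = J then 1 else 0) else 0)"
    unfolding wedge_coord_def by (intro sum.cong refl) (subst entry, auto simp: sign_id)
  also have "\<dots> = (if I = J then 1 else 0)"
    by (subst sum.delta) (auto simp: permutes_id finite_permutations)
  finally show ?thesis .
qed

end

theory Submission
  imports Defs
begin

text \<open>Every part of the theorem is read off from a singular value decomposition
  \<open>X = U diag(s) V\<^sup>T\<close> with \<open>U\<close>, \<open>V\<close> orthogonal and \<open>s \<ge> 0\<close> (\<open>singular_value_decomposition\<close>). The list of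
  singular values of \<open>X\<close> is \<open>s\<close> in decreasing order (\<open>singular_values_svd\<close>), so the two norm balls
  are the conditions \<open>s\<^sub>i \<le> 1\<close> for all \<open>i\<close>, and \<open>\<Sum>\<^sub>i s\<^sub>i \<le> 1\<close>.

  Convex combinations of orthogonal matrices do not increase the length of vectors, which gives
  \<open>s\<^sub>i \<le> 1\<close>. Conversely, a vector \<open>s\<close> in the cube \<open>[-1, 1]\<^sup>n\<close> is a convex combination of sign vectors, and
  \<open>U diag(\<plusminus>1) V\<^sup>T\<close> is orthogonal. Hence the hull of the orthogonal group is the set of
  contractions (\<open>in_orthogonal_hull_iff_svd\<close>, \<open>in_orthogonal_hull_iff_contraction\<close>), and completing the
  square turns \<open>|X x| \<le> |x|\<close> into positive semidefiniteness of the block matrix. For the polar body,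
  \<open>\<langle>Z, U diag(s) V\<^sup>T\<rangle> = \<Sum>\<^sub>i s\<^sub>i \<langle>u\<^sub>i, Z v\<^sub>i\<rangle>\<close> is at most \<open>\<Sum>\<^sub>i s\<^sub>i\<close> on contractions \<open>Z\<close>, with equality at
  \<open>Z = U V\<^sup>T\<close> (\<open>in_polar_orthogonal_hull_iff_svd\<close>).

  The second matrix inequality rests on the eigenvalues of \<open>S(X)\<close>, which are \<open>\<plusminus>s\<^sub>i\<close> with an orthonormal
  basis of eigenvectors built from the columns of \<open>U\<close> and \<open>V\<close>. By the Cauchy--Binet formula
  (\<open>wedge_coord_mult\<close>) the wedge products of an orthonormal basis are an orthonormal basis of the exterior
  power; they are eigenvectors of the additive compound, with the sums of \<open>n\<close> of the numbers \<open>\<plusminus>s\<^sub>i\<close> as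
  eigenvalues (\<open>additive_compound_spectral\<close>). So the identity minus the compound is positive semidefinite
  exactly if the largest of these sums, \<open>\<Sum>\<^sub>i s\<^sub>i\<close>, is at most \<open>1\<close>. Both inequalities are affine in \<open>X\<close>, so
  they describe spectrahedra.\<close>


section \<open>Singular value decomposition\<close>

definition diagonal :: "('n \<Rightarrow> real) \<Rightarrow> real^'n^'n" where
  "diagonal s = (\<chi> i j. if i = j then s i else 0)"

text \<open>The diagonal entries are indexed by the index type of the matrices and are not sorted: the
  conditions on singular values that occur below are symmetric in them.\<close>
definition is_svd :: "real^'n^'n \<Rightarrow> ('n \<Rightarrow> real) \<Rightarrow> real^'n^'n \<Rightarrow> real^'n^'n \<Rightarrow> bool" where
  "is_svd U s V X \<longleftrightarrow> orthogonal_matrix U \<and> orthogonal_matrix V \<and> (\<forall>i. 0 \<le> s i) \<and>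
     X = U ** diagonal s ** transpose V"

lemma inner_transpose_mult:
  fixes X :: "real^'n^'m"
  shows "y \<bullet> (X *v x) = (transpose X *v y) \<bullet> x"
  by (simp add: dot_lmul_matrix)

text \<open>The bilinear form \<open>y \<bullet> (X *v x)\<close> attains its maximum \<open>m\<close> over unit vectors of \<open>T\<close> and \<open>S\<close>.
  At a maximiser \<open>(u, v)\<close>, the vector \<open>X *v v\<close> has length at most \<open>m\<close> and component \<open>m\<close> along \<open>u\<close>, so
  it equals \<open>m *\<^sub>R u\<close>; the transposed equation holds for the same reason.\<close>
lemma exists_maximal_singular_pair:
  fixes X :: "real^'n^'m"
  assumes T: "subspace T" "0 < dim T" and S: "subspace S" "0 < dim S"
    and XS: "\<And>x. x \<in> S \<Longrightarrow> X *v x \<in> T" and XT: "\<And>y. y \<in> T \<Longrightarrow> transpose X *v y \<in> S"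
  obtains u v m where "u \<in> T" "norm u = 1" "v \<in> S" "norm v = 1" "0 \<le> m"
    "X *v v = m *\<^sub>R u" "transpose X *v u = m *\<^sub>R v"
proof -
  have unit: "\<exists>x\<in>A. norm x = 1" if A: "subspace A" "0 < dim A" for A :: "'c::euclidean_space set"
  proof -
    have "A \<noteq> {0}" using A(2) by auto
    then obtain a where "a \<in> A" "a \<noteq> 0" using subspace_0[OF A(1)] by blast
    then show ?thesis
      by (intro bexI[of _ "(1 / norm a) *\<^sub>R a"]) (auto intro: subspace_scale[OF A(1)])
  qed
  let ?K = "(T \<inter> sphere 0 1) \<times> (S \<inter> sphere 0 1)"
  have "compact ?K"
    by (intro compact_Times closed_Int_compact closed_subspace T S compact_sphere)
  moreover have "?K \<noteq> {}" using unit[OF T] unit[OF S] by auto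
  moreover have "continuous_on ?K (\<lambda>z. fst z \<bullet> (X *v snd z))"
    by (intro continuous_intros linear_continuous_on_compose[OF _ matrix_vector_mul_linear])
  ultimately have "\<exists>z\<in>?K. \<forall>w\<in>?K. fst w \<bullet> (X *v snd w) \<le> fst z \<bullet> (X *v snd z)"
    by (rule continuous_attains_sup)
  then obtain z where z: "z \<in> ?K"
    and max: "\<forall>w\<in>?K. fst w \<bullet> (X *v snd w) \<le> fst z \<bullet> (X *v snd z)" by blast
  obtain u v where uv: "z = (u, v)" by fastforce
  define m where "m = u \<bullet> (X *v v)"
  have u: "u \<in> T" "norm u = 1" and v: "v \<in> S" "norm v = 1" using z uv by auto
  have le: "a \<bullet> (X *v b) \<le> m" if "a \<in> T" "norm a = 1" "b \<in> S" "norm b = 1" for a b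
    using max[rule_format, of "(a, b)"] that uv by (simp add: m_def)
  have m0: "0 \<le> m"
    using le[of "- u" v] u v subspace_neg[OF T(1)] by (simp add: m_def)
  \<comment> \<open>a vector of length at most \<open>m\<close> whose component along a unit vector is \<open>m\<close> is \<open>m\<close> times it\<close>
  have eq: "w = m *\<^sub>R a" if "w \<in> A" "subspace A" "norm a = 1" "a \<bullet> w = m"
    "\<And>b. b \<in> A \<Longrightarrow> norm b = 1 \<Longrightarrow> b \<bullet> w \<le> m" for w a :: "'c::euclidean_space" and A
  proof -
    have "norm w \<le> m"
    proof (cases "w = 0")
      case False
      have "(1 / norm w) *\<^sub>R w \<bullet> w \<le> m"
        by (rule that(5)) (use that False in \<open>auto intro: subspace_scale\<close>)
      then show ?thesis using False by (simp add: dot_square_norm power2_eq_square)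
    qed (use m0 in simp)
    then have "w \<bullet> w \<le> m * m"
      by (simp add: dot_square_norm power2_eq_square mult_mono m0)
    moreover have "(w - m *\<^sub>R a) \<bullet> (w - m *\<^sub>R a) = w \<bullet> w - m * m"
      using that(3,4) by (simp add: inner_diff inner_commute norm_eq_1)
    ultimately have "(w - m *\<^sub>R a) \<bullet> (w - m *\<^sub>R a) \<le> 0" by simp
    then have "(w - m *\<^sub>R a) \<bullet> (w - m *\<^sub>R a) = 0"
      by (rule order_antisym) (rule inner_ge_zero)
    then show ?thesis by (simp only: inner_eq_zero_iff right_minus_eq)
  qed
  have "X *v v = m *\<^sub>R u"
    by (rule eq[OF XS T(1)]) (use u v le in \<open>auto simp: m_def\<close>)
  moreover have "transpose X *v u = m *\<^sub>R v"
  proof (rule eq[OF XT S(1)])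
    show "v \<bullet> (transpose X *v u) = m"
      by (simp only: m_def inner_transpose_mult[of u] inner_commute)
    show "b \<bullet> (transpose X *v u) \<le> m" if "b \<in> S" "norm b = 1" for b
      using le[OF u that] by (simp only: inner_transpose_mult[of u] inner_commute)
  qed (use u v in auto)
  ultimately show ?thesis using that u v m0 by blast
qed

text \<open>Splitting off a maximal pair \<open>(u, v)\<close> leaves the orthogonal complements of \<open>u\<close> in \<open>T\<close> and of
  \<open>v\<close> in \<open>S\<close>, which \<open>X\<close> and its transpose again map into each other. The spaces \<open>S\<close> and \<open>T\<close> of
  equal dimension make the statement inductive, and zero singular values need no separate completion
  to an orthonormal basis.\<close>
lemma exists_singular_bases:
  fixes X :: "real^'n^'m"
  assumes "finite I" "subspace T" "subspace S" "dim T = card I" "dim S = card I"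
    and "\<And>x. x \<in> S \<Longrightarrow> X *v x \<in> T" and "\<And>y. y \<in> T \<Longrightarrow> transpose X *v y \<in> S"
  shows "\<exists>u v s. (\<forall>i\<in>I. u i \<in> T \<and> v i \<in> S \<and> 0 \<le> s i \<and> X *v v i = s i *\<^sub>R u i) \<and>
    (\<forall>i\<in>I. \<forall>j\<in>I. u i \<bullet> u j = (if i = j then 1 else 0) \<and> v i \<bullet> v j = (if i = j then 1 else 0))"
  using assms
proof (induction I arbitrary: S T rule: finite_induct)
  case empty
  then show ?case by auto
next
  case (insert k I)
  obtain a b m where a: "a \<in> T" "norm a = 1" and b: "b \<in> S" "norm b = 1" and m: "0 \<le> m"
    and ab: "X *v b = m *\<^sub>R a" "transpose X *v a = m *\<^sub>R b"
    using exists_maximal_singular_pair[of T S X] insert by auto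
  let ?T = "{y \<in> T. a \<bullet> y = 0}" and ?S = "{x \<in> S. b \<bullet> x = 0}"
  have complement: "subspace {y \<in> A. c \<bullet> y = 0}" "dim {y \<in> A. c \<bullet> y = 0} + 1 = dim A"
    if A: "subspace A" "c \<in> A" "norm c = 1" for A and c :: "'c::euclidean_space"
  proof -
    have "{y \<in> A. c \<bullet> y = 0} = A \<inter> {y. c \<bullet> y = 0}" by auto
    then show "subspace {y \<in> A. c \<bullet> y = 0}"
      using subspace_inter[OF A(1) subspace_hyperplane] by simp
    have "span {c} \<subseteq> A" using A by (intro span_minimal) auto
    moreover have "(\<forall>x\<in>span {c}. orthogonal x y) \<longleftrightarrow> c \<bullet> y = 0" for y
      by (auto simp: span_singleton orthogonal_def)
    moreover have "dim (span {c}) = 1"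
      using A(3) by (auto simp: dim_singleton)
    ultimately show "dim {y \<in> A. c \<bullet> y = 0} + 1 = dim A"
      using dim_subspace_orthogonal_to_vectors[OF subspace_span A(1), of "{c}"] by simp
  qed
  have XS: "X *v x \<in> ?T" if "x \<in> ?S" for x
    using insert.prems(5)[of x] that ab(2) by (simp add: inner_transpose_mult[of a])
  have XT: "transpose X *v y \<in> ?S" if "y \<in> ?T" for y
    using insert.prems(6)[of y] that ab(1) inner_transpose_mult[of b "transpose X" y] by simp
  obtain u v s where IH: "\<forall>i\<in>I. u i \<in> ?T \<and> v i \<in> ?S \<and> 0 \<le> s i \<and> X *v v i = s i *\<^sub>R u i"
     "\<forall>i\<in>I. \<forall>j\<in>I. u i \<bullet> u j = (if i = j then 1 else 0) \<and> v i \<bullet> v j = (if i = j then 1 else 0)"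
    using insert.IH[of ?T ?S] complement[OF insert.prems(1) a] complement[OF insert.prems(2) b]
      insert.prems(3,4) insert.hyps XS XT by fastforce
  show ?case
    by (rule exI[of _ "u(k := a)"], rule exI[of _ "v(k := b)"], rule exI[of _ "s(k := m)"])
      (use IH insert.hyps a b m ab in \<open>auto simp: norm_eq_1 inner_commute\<close>)
qed

lemma mult_diagonal_entry: "(A ** diagonal s) $ i $ j = A $ i $ j * s j"
  by (simp add: matrix_matrix_mult_def diagonal_def if_distrib[of "(*) _"] cong: if_cong)

lemma singular_value_decomposition:
  fixes X :: "real^'n^'n"
  obtains U s V where "is_svd U s V X"
proof -
  obtain u v :: "'n \<Rightarrow> real^'n" and s where *: "\<forall>i. 0 \<le> s i \<and> X *v v i = s i *\<^sub>R u i"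
    "\<forall>i j. u i \<bullet> u j = (if i = j then 1 else 0) \<and> v i \<bullet> v j = (if i = j then 1 else 0)"
    using exists_singular_bases[of "UNIV :: 'n set" UNIV UNIV X] by auto
  define U :: "real^'n^'n" where "U = (\<chi> i j. u j $ i)"
  define V :: "real^'n^'n" where "V = (\<chi> i j. v j $ i)"
  have "transpose U ** U = mat 1" "transpose V ** V = mat 1"
    using * by (simp_all add: U_def V_def matrix_matrix_mult_def transpose_def mat_def inner_vec_def vec_eq_iff)
  then have UV: "orthogonal_matrix U" "orthogonal_matrix V" by (simp_all add: orthogonal_matrix)
  have "(X ** V) $ i $ j = (U ** diagonal s) $ i $ j" for i j
    using arg_cong[OF *(1)[rule_format, of j, THEN conjunct2], of "\<lambda>x. x $ i"]
    by (simp add: mult_diagonal_entry) (simp add: matrix_matrix_mult_def matrix_vector_mult_def U_def V_def mult.commute)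
  then have "X ** V = U ** diagonal s" by (simp add: vec_eq_iff)
  then have "X = U ** diagonal s ** transpose V"
    using UV(2) by (metis matrix_mul_assoc matrix_mul_rid orthogonal_matrix_def)
  with UV * show ?thesis by (intro that[of U s V]) (auto simp: is_svd_def)
qed


section \<open>Singular values from a decomposition\<close>

lemma orthogonal_matrix_mults:
  assumes "orthogonal_matrix U"
  shows "transpose U ** U = mat 1" "U ** transpose U = mat 1"
  using assms by (auto simp: orthogonal_matrix_def)

lemma matrix_diff_ldistrib: "(A :: real^'n^'m) ** (B - C) = A ** B - A ** C"
  and matrix_diff_rdistrib: "(B' - C') ** (A' :: real^'n^'m) = B' ** A' - C' ** A'"
  by (simp_all add: matrix_matrix_mult_def vec_eq_iff algebra_simps sum_subtractf)

lemma matrix_add_rdistrib: "((B :: real^'n^'m) + C) ** A = B ** A + C ** A"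
  by (simp add: matrix_matrix_mult_def vec_eq_iff algebra_simps sum.distrib)

lemma poly_charpoly_mat: "poly (charpoly_mat A) x = det (mat x - A)"
  unfolding charpoly_mat_def det_def poly_sum
  by (intro sum.cong refl)
    (auto simp: poly_prod mat_def sign_def algebra_simps intro!: prod.cong)

lemma det_orthogonal_similar:
  fixes A :: "real^'n^'n"
  assumes V: "orthogonal_matrix V"
  shows "det (V ** A ** transpose V) = det A"
proof -
  have "det V * det (transpose V) = det (V ** transpose V)" by (simp add: det_mul)
  also have "\<dots> = 1" by (simp add: orthogonal_matrix_mults[OF V])
  finally show ?thesis by (simp add: det_mul mult.commute mult.left_commute)
qed

text \<open>Two real polynomials that agree at all points are equal, so the conjugation by \<open>V\<close> can be
  removed inside an ordinary real determinant, without working over the polynomial ring.\<close>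
lemma charpoly_mat_orthogonal_diagonal:
  fixes V :: "real^'n^'n"
  assumes V: "orthogonal_matrix V"
  shows "charpoly_mat (V ** diagonal d ** transpose V) = (\<Prod>i\<in>UNIV. [:- d i, 1:])"
proof -
  have "poly (charpoly_mat (V ** diagonal d ** transpose V)) x = poly (\<Prod>i\<in>UNIV. [:- d i, 1:]) x" for x
  proof -
    have "V ** mat x ** transpose V = mat x"
    proof -
      have "mat x = x *\<^sub>R (mat 1 :: real^'n^'n)" by (simp add: mat_def vec_eq_iff)
      then show ?thesis
        by (simp only: matrix_scalar_ac scalar_matrix_assoc[symmetric] matrix_mul_rid orthogonal_matrix_mults[OF V])
    qed
    then have "mat x - V ** diagonal d ** transpose V = V ** (mat x - diagonal d) ** transpose V"
      by (metis matrix_diff_ldistrib matrix_diff_rdistrib)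
    then have "poly (charpoly_mat (V ** diagonal d ** transpose V)) x = det (mat x - diagonal d)"
      by (simp only: poly_charpoly_mat det_orthogonal_similar[OF V])
    also have "\<dots> = (\<Prod>i\<in>UNIV. x - d i)"
      by (subst det_diagonal) (auto simp: mat_def diagonal_def)
    finally show ?thesis by (simp add: poly_prod)
  qed
  then show ?thesis by (simp add: poly_eq_poly_eq_iff[symmetric] fun_eq_iff)
qed

text \<open>The diagonal of any singular value decomposition is the list of singular values up to order,
  because \<open>transpose X ** X\<close> is then orthogonally similar to the diagonal matrix of the squares.\<close>
lemma singular_values_svd:
  assumes "is_svd U s V X"
  shows "mset (singular_values X) = image_mset s (mset_set UNIV)"
proof -
  have U: "orthogonal_matrix U" and V: "orthogonal_matrix V" and s: "\<And>i. 0 \<le> s i"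
    and X: "X = U ** diagonal s ** transpose V" using assms by (auto simp: is_svd_def)
  have D: "transpose (diagonal s) ** diagonal s = diagonal (\<lambda>i. (s i)\<^sup>2)"
    by (simp add: vec_eq_iff mult_diagonal_entry) (simp add: diagonal_def transpose_def power2_eq_square)
  have "transpose X ** X = V ** (transpose (diagonal s) ** (transpose U ** U) ** diagonal s) ** transpose V"
    unfolding X by (simp only: matrix_transpose_mul transpose_transpose matrix_mul_assoc)
  also have "\<dots> = V ** diagonal (\<lambda>i. (s i)\<^sup>2) ** transpose V"
    by (simp add: orthogonal_matrix_mults[OF U] D)
  finally have "charpoly_mat (transpose X ** X) = (\<Prod>i\<in>UNIV. [:- (s i)\<^sup>2, 1:])"
    using charpoly_mat_orthogonal_diagonal[OF V] by simp
  moreover have "proots (\<Prod>i\<in>UNIV. [:- (s i)\<^sup>2, 1:]) = (\<Sum>i\<in>UNIV. proots [:- (s i)\<^sup>2, 1:])"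
    by (rule proots_prod) simp
  moreover have "(\<Sum>i\<in>A. proots [:- (s i)\<^sup>2, 1:]) = image_mset (\<lambda>i. (s i)\<^sup>2) (mset_set A)"
    if "finite A" for A using that by induction auto
  ultimately have "proots (charpoly_mat (transpose X ** X)) = image_mset (\<lambda>i. (s i)\<^sup>2) (mset_set UNIV)"
    by simp
  then have "image_mset sqrt (proots (charpoly_mat (transpose X ** X))) = image_mset s (mset_set UNIV)"
    using s by (simp add: multiset.map_comp o_def)
  then show ?thesis by (simp only: singular_values_def mset_rev mset_sorted_list_of_multiset)
qed

lemma sum_singular_values_svd:
  fixes X :: "real^'n^'n"
  assumes "is_svd U s V X"
  shows "(\<Sum>i = 1..CARD('n). singular_value i X) = (\<Sum>i\<in>UNIV. s i)"
proof -
  have len: "length (singular_values X) = CARD('n)"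
    using arg_cong[OF singular_values_svd[OF assms], of size] by simp
  have "(\<Sum>i = 1..CARD('n). singular_value i X) = (\<Sum>i<CARD('n). singular_values X ! i)"
    by (rule sum.reindex_bij_witness[of _ Suc "\<lambda>i. i - 1"]) (auto simp: singular_value_def)
  also have "\<dots> = sum_list (singular_values X)"
    by (simp add: sum_list_sum_nth len atLeast0LessThan)
  also have "\<dots> = sum_mset (mset (singular_values X))" by (simp add: sum_mset_sum_list)
  also have "\<dots> = (\<Sum>i\<in>UNIV. s i)" by (simp add: singular_values_svd[OF assms] sum_unfold_sum_mset)
  finally show ?thesis .
qed

lemma singular_value_1_le_svd:
  fixes X :: "real^'n^'n"
  assumes "is_svd U s V X"
  shows "singular_value 1 X \<le> c \<longleftrightarrow> (\<forall>i. s i \<le> c)"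
proof -
  have set: "set (singular_values X) = range s"
    using arg_cong[OF singular_values_svd[OF assms], of set_mset] by simp
  then have ne: "singular_values X \<noteq> []" by auto
  have "sorted_wrt (\<ge>) (singular_values X)"
    by (simp add: singular_values_def sorted_wrt_rev)
  then have "\<forall>x\<in>set (singular_values X). x \<le> hd (singular_values X)"
    using ne by (cases "singular_values X") auto
  moreover have "hd (singular_values X) \<in> set (singular_values X)" using ne by simp
  moreover have "singular_value 1 X = hd (singular_values X)"
    using ne by (simp add: singular_value_def hd_conv_nth)
  ultimately show ?thesis using set by (metis (no_types, lifting) dual_order.trans imageE rangeI)
qed


section \<open>The hull of the orthogonal group and its polar body\<close>

lemma svd_mult_columns:
  assumes "is_svd U s V X"
  shows "X *v column i V = s i *\<^sub>R column i U" "transpose X *v column i U = s i *\<^sub>R column i V"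
proof -
  have U: "orthogonal_matrix U" and V: "orthogonal_matrix V"
    and X: "X = U ** diagonal s ** transpose V" using assms by (auto simp: is_svd_def)
  have *: "A *v column i B = s i *\<^sub>R column i W"
    if "A = W ** diagonal s ** transpose B" "orthogonal_matrix B" for A B W :: "real^'a^'a"
  proof -
    have "A ** B = W ** diagonal s"
      using that by (simp add: orthogonal_matrix_mults flip: matrix_mul_assoc)
    then have "(A ** B) $ k $ i = W $ k $ i * s i" for k by (simp add: mult_diagonal_entry)
    then show ?thesis
      by (simp add: vec_eq_iff matrix_vector_mult_def matrix_matrix_mult_def column_def mult.commute)
  qed
  show "X *v column i V = s i *\<^sub>R column i U" by (rule *[OF X V])
  have "transpose (diagonal s) = diagonal s" by (auto simp: transpose_def diagonal_def vec_eq_iff)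
  then have "transpose X = V ** diagonal s ** transpose U"
    unfolding X by (simp add: matrix_transpose_mul matrix_mul_assoc)
  then show "transpose X *v column i U = s i *\<^sub>R column i V" by (rule *[OF _ U])
qed

lemma orthonormal_columns:
  fixes U :: "real^'n^'n"
  assumes "orthogonal_matrix U"
  shows "column i U \<bullet> column j U = (if i = j then 1 else 0)" "norm (column i U) = 1"
  using assms by (auto simp: orthogonal_matrix_orthonormal_columns orthogonal_def norm_eq_1)

text \<open>The right factor is \<open>\<Sum>\<^sub>i s\<^sub>i u\<^sub>i v\<^sub>i\<^sup>T\<close> with \<open>u\<^sub>i\<close>, \<open>v\<^sub>i\<close> the columns of \<open>U\<close>, \<open>V\<close>, and the inner product
  of \<open>Z\<close> with \<open>u v\<^sup>T\<close> is \<open>u \<bullet> (Z *v v)\<close>.\<close>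
lemma inner_svd:
  "Z \<bullet> (U ** diagonal s ** transpose V) = (\<Sum>i\<in>UNIV. s i * (column i U \<bullet> (Z *v column i V)))"
proof -
  have "Z \<bullet> (U ** diagonal s ** transpose V) =
      (\<Sum>a\<in>UNIV. \<Sum>b\<in>UNIV. \<Sum>i\<in>UNIV. Z $ a $ b * (U $ a $ i * s i * V $ b $ i))"
    by (simp add: inner_vec_def matrix_matrix_mult_def[of "_ ** _"] mult_diagonal_entry transpose_def sum_distrib_left)
  also have "\<dots> = (\<Sum>i\<in>UNIV. \<Sum>a\<in>UNIV. \<Sum>b\<in>UNIV. Z $ a $ b * (U $ a $ i * s i * V $ b $ i))"
    by (subst sum.swap[of _ _ UNIV], subst (2) sum.swap) (rule refl)
  also have "\<dots> = (\<Sum>i\<in>UNIV. s i * (column i U \<bullet> (Z *v column i V)))"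
    by (simp add: inner_vec_def matrix_vector_mult_def column_def sum_distrib_left mult_ac)
  finally show ?thesis .
qed

lemma norm_power2_svd:
  assumes "is_svd U s V X"
  shows "(norm X)\<^sup>2 = (\<Sum>i\<in>UNIV. (s i)\<^sup>2)"
proof -
  have "X \<bullet> X = (\<Sum>i\<in>UNIV. s i * (column i U \<bullet> (X *v column i V)))"
    using inner_svd[of X U s V] assms by (simp add: is_svd_def)
  also have "\<dots> = (\<Sum>i\<in>UNIV. (s i)\<^sup>2)"
    using assms unfolding svd_mult_columns[OF assms]
    by (simp add: orthonormal_columns is_svd_def power2_eq_square)
  finally show ?thesis by (simp add: power2_norm_eq_inner)
qed

lemma svd_le_norm:
  assumes "is_svd U s V X"
  shows "s i \<le> norm X"
proof (rule power2_le_imp_le)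
  show "(s i)\<^sup>2 \<le> (norm X)\<^sup>2"
    unfolding norm_power2_svd[OF assms] by (rule member_le_sum) auto
qed simp

text \<open>A point of the cube \<open>[-1, 1]\<^sup>n\<close> is a convex combination of sign vectors, and for a sign vector
  \<open>s\<close> the matrix \<open>U ** diagonal s ** transpose V\<close> is orthogonal. The set \<open>I\<close> contains the coordinates
  that are not yet signs; the induction removes them one at a time.\<close>
lemma orthogonal_diagonal_in_hull:
  fixes U :: "real^'n^'n"
  assumes U: "orthogonal_matrix U" and V: "orthogonal_matrix V"
    and "finite I" "\<forall>i. \<bar>s i\<bar> \<le> 1" "\<forall>i. i \<notin> I \<longrightarrow> \<bar>s i\<bar> = 1"
  shows "U ** diagonal s ** transpose V \<in> convex hull orthogonal_group"
  using assms(3-)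
proof (induction I arbitrary: s rule: finite_induct)
  case empty
  have "transpose (diagonal s) ** diagonal s = mat 1"
  proof -
    have "s i * s i = 1" for i
      using empty by (metis abs_mult_self_eq empty_iff mult.right_neutral)
    then show ?thesis
      by (simp add: vec_eq_iff mult_diagonal_entry mat_def) (simp add: diagonal_def transpose_def)
  qed
  then have "orthogonal_matrix (U ** diagonal s ** transpose V)"
    using U V by (intro orthogonal_matrix_mul) (simp_all add: orthogonal_matrix_transpose, simp add: orthogonal_matrix)
  then show ?case by (intro hull_inc) (simp add: orthogonal_group_def)
next
  case (insert k I)
  let ?M = "\<lambda>s. U ** diagonal s ** transpose V"
  let ?a = "(1 + s k) / 2" and ?b = "(1 - s k) / 2"
  have sk: "\<bar>s k\<bar> \<le> 1" using insert by auto
  \<comment> \<open>\<open>s k\<close> is the mean of \<open>1\<close> and \<open>-1\<close> with the weights \<open>?a\<close> and \<open>?b\<close>\<close>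
  have "?M (s(k := c)) \<in> convex hull orthogonal_group" if "\<bar>c\<bar> = 1" for c
    using insert.prems that by (intro insert.IH) auto
  then have "?a *\<^sub>R ?M (s(k := 1)) + ?b *\<^sub>R ?M (s(k := -1)) \<in> convex hull orthogonal_group"
    using sk by (intro convexD convex_convex_hull) (auto simp: field_simps)
  also have "?a *\<^sub>R ?M (s(k := 1)) + ?b *\<^sub>R ?M (s(k := -1)) =
      U ** (?a *\<^sub>R diagonal (s(k := 1)) + ?b *\<^sub>R diagonal (s(k := -1))) ** transpose V"
    by (simp only: matrix_add_ldistrib matrix_add_rdistrib matrix_scalar_ac scalar_matrix_assoc)
  also have "?a *\<^sub>R diagonal (s(k := 1)) + ?b *\<^sub>R diagonal (s(k := -1)) = diagonal s"
    by (auto simp: vec_eq_iff diagonal_def field_simps)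
  finally show ?case .
qed

lemma contraction_if_in_orthogonal_hull:
  fixes X :: "real^'n^'n"
  assumes "X \<in> convex hull orthogonal_group"
  shows "norm (X *v x) \<le> norm x"
proof -
  let ?N = "{X :: real^'n^'n. norm (X *v x) \<le> norm x}"
  have "convex ?N"
  proof (rule convexI)
    fix X Y :: "real^'n^'n" and a b :: real
    assume *: "X \<in> ?N" "Y \<in> ?N"
      "0 \<le> a" "0 \<le> b" "a + b = 1"
    have "norm ((a *\<^sub>R X + b *\<^sub>R Y) *v x) = norm (a *\<^sub>R (X *v x) + b *\<^sub>R (Y *v x))"
      by (simp add: matrix_vector_mult_add_rdistrib scaleR_matrix_vector_assoc)
    also have "\<dots> \<le> a * norm (X *v x) + b * norm (Y *v x)"
      using * norm_triangle_ineq[of "a *\<^sub>R (X *v x)" "b *\<^sub>R (Y *v x)"] by simp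
    also have "\<dots> \<le> norm x"
      using * by (intro convex_bound_le) auto
    finally show "a *\<^sub>R X + b *\<^sub>R Y \<in> ?N" by simp
  qed
  moreover have "orthogonal_group \<subseteq> ?N"
  proof
    fix Q :: "real^'n^'n" assume "Q \<in> orthogonal_group"
    then have "orthogonal_transformation ((*v) Q)"
      by (simp add: orthogonal_group_def orthogonal_transformation_matrix)
    then show "Q \<in> ?N" by (simp add: orthogonal_transformation)
  qed
  ultimately show ?thesis using assms hull_minimal[of orthogonal_group _ convex] by blast
qed

lemma in_orthogonal_hull_iff_svd:
  assumes X: "is_svd U s V X"
  shows "X \<in> convex hull orthogonal_group \<longleftrightarrow> (\<forall>i. s i \<le> 1)"
proof
  assume "X \<in> convex hull orthogonal_group"
  then have "norm (X *v column i V) \<le> norm (column i V)" for i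
    by (rule contraction_if_in_orthogonal_hull)
  then show "\<forall>i. s i \<le> 1"
    using X by (simp add: svd_mult_columns[OF X] orthonormal_columns is_svd_def)
next
  assume "\<forall>i. s i \<le> 1"
  then show "X \<in> convex hull orthogonal_group"
    using X orthogonal_diagonal_in_hull[of U V UNIV s] by (simp add: is_svd_def)
qed

lemma in_orthogonal_hull_iff_contraction:
  "X \<in> convex hull orthogonal_group \<longleftrightarrow> (\<forall>x. norm (X *v x) \<le> norm x)"
proof
  assume *: "\<forall>x. norm (X *v x) \<le> norm x"
  obtain U s V where X: "is_svd U s V X" by (rule singular_value_decomposition)
  have "s i \<le> 1" for i
    using *[rule_format, of "column i V"] X
    by (simp add: svd_mult_columns[OF X] orthonormal_columns is_svd_def)
  then show "X \<in> convex hull orthogonal_group" by (simp add: in_orthogonal_hull_iff_svd[OF X])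
qed (simp add: contraction_if_in_orthogonal_hull)

lemma polar_body_eq_inner: "polar_body K = {Y. \<forall>X\<in>K. X \<bullet> Y \<le> 1}"
proof -
  have "trace (transpose X ** Y) = X \<bullet> Y" for X Y :: "real^'a^'a"
    unfolding trace_def inner_vec_def matrix_matrix_mult_def transpose_def
    by simp (rule sum.swap)
  then show ?thesis by (simp add: polar_body_def)
qed

text \<open>This is the duality of the operator norm and the nuclear norm. The orthogonal matrix
  \<open>U ** transpose V\<close> is the point of the hull at which the linear form given by \<open>Y\<close> is largest, with
  value \<open>\<Sum>\<^sub>i s\<^sub>i\<close>; no contraction exceeds it because each \<open>u\<^sub>i \<bullet> (Z *v v\<^sub>i)\<close> is at most \<open>1\<close>.\<close>
lemma in_polar_orthogonal_hull_iff_svd: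
  fixes Y :: "real^'n^'n"
  assumes Y: "is_svd U s V Y"
  shows "Y \<in> polar_body (convex hull orthogonal_group) \<longleftrightarrow> (\<Sum>i\<in>UNIV. s i) \<le> 1"
proof -
  have U: "orthogonal_matrix U" and V: "orthogonal_matrix V" and s: "\<And>i. 0 \<le> s i"
    and Y_eq: "Y = U ** diagonal s ** transpose V" using Y by (auto simp: is_svd_def)
  show ?thesis
  proof
    assume *: "Y \<in> polar_body (convex hull orthogonal_group)"
    have "diagonal (\<lambda>_. 1) = (mat 1 :: real^'n^'n)" by (simp add: diagonal_def mat_def vec_eq_iff)
    then have svd: "is_svd U (\<lambda>_. 1) V (U ** transpose V)" using U V by (simp add: is_svd_def)
    then have "U ** transpose V \<in> convex hull orthogonal_group"
      by (simp add: in_orthogonal_hull_iff_svd)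
    then have "(U ** transpose V) \<bullet> Y \<le> 1" using * by (simp add: polar_body_eq_inner)
    moreover have "(U ** transpose V) \<bullet> Y = (\<Sum>i\<in>UNIV. s i)"
      using svd_mult_columns(1)[OF svd] by (simp add: Y_eq inner_svd orthonormal_columns[OF U])
    ultimately show "(\<Sum>i\<in>UNIV. s i) \<le> 1" by simp
  next
    assume sum: "(\<Sum>i\<in>UNIV. s i) \<le> 1"
    have "Z \<bullet> Y \<le> 1" if Z: "Z \<in> convex hull orthogonal_group" for Z
    proof -
      have "column i U \<bullet> (Z *v column i V) \<le> 1" for i
      proof -
        have "column i U \<bullet> (Z *v column i V) \<le> norm (column i U) * norm (Z *v column i V)"
          by (rule norm_cauchy_schwarz)
        also have "\<dots> \<le> 1"
          using contraction_if_in_orthogonal_hull[OF Z, of "column i V"]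
          by (simp add: orthonormal_columns[OF U] orthonormal_columns[OF V])
        finally show ?thesis .
      qed
      then have "Z \<bullet> Y \<le> (\<Sum>i\<in>UNIV. s i * 1)"
        unfolding Y_eq inner_svd by (intro sum_mono mult_left_mono s)
      then show ?thesis using sum by simp
    qed
    then show "Y \<in> polar_body (convex hull orthogonal_group)" by (simp add: polar_body_eq_inner)
  qed
qed


section \<open>Both sets are convex bodies\<close>

lemma convex_body_orthogonal_hull:
  "convex_body (convex hull orthogonal_group :: (real^'n^'n) set)"
proof -
  let ?C = "convex hull orthogonal_group :: (real^'n^'n) set"
  have "norm X \<le> sqrt (CARD('n))" if "X \<in> ?C" for X
  proof -
    obtain U s V where X: "is_svd U s V X" by (rule singular_value_decomposition)
    then have s: "0 \<le> s i" "s i \<le> 1" for i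
      using that in_orthogonal_hull_iff_svd[OF X] by (auto simp: is_svd_def)
    have "(norm X)\<^sup>2 \<le> (\<Sum>i\<in>(UNIV :: 'n set). 1)"
      unfolding norm_power2_svd[OF X] by (intro sum_mono power_le_one s)
    then show ?thesis by (intro real_le_rsqrt) simp
  qed
  then have "bounded ?C" unfolding bounded_iff by blast
  moreover have "closed ?C"
  proof -
    have "?C = (\<Inter>x. {X. norm (X *v x) \<le> norm x})" by (auto simp: in_orthogonal_hull_iff_contraction)
    moreover have "closed {X :: real^'n^'n. norm (X *v x) \<le> norm x}" for x
      unfolding matrix_vector_mult_def by (intro closed_Collect_le continuous_intros)
    ultimately show ?thesis by auto
  qed
  moreover have "ball 0 1 \<subseteq> ?C"
  proof
    fix X :: "real^'n^'n" assume X: "X \<in> ball 0 1"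
    obtain U s V where svd: "is_svd U s V X" by (rule singular_value_decomposition)
    have "s i \<le> 1" for i using svd_le_norm[OF svd, of i] X by simp
    then show "X \<in> ?C" by (simp add: in_orthogonal_hull_iff_svd[OF svd])
  qed
  then have "ball 0 1 \<subseteq> interior ?C" by (simp add: interior_maximal)
  then have "interior ?C \<noteq> {}" by fastforce
  ultimately show ?thesis by (simp add: convex_body_def compact_eq_bounded_closed)
qed

lemma convex_body_polar_orthogonal_hull:
  "convex_body (polar_body (convex hull orthogonal_group :: (real^'n^'n) set))"
proof -
  let ?P = "polar_body (convex hull orthogonal_group :: (real^'n^'n) set)"
  have P: "?P = (\<Inter>X\<in>convex hull orthogonal_group. {Y. X \<bullet> Y \<le> 1})"
    by (auto simp: polar_body_eq_inner)
  have "norm Y \<le> 1" if "Y \<in> ?P" for Y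
  proof -
    obtain U s V where Y: "is_svd U s V Y" by (rule singular_value_decomposition)
    then have s: "0 \<le> s i" for i by (auto simp: is_svd_def)
    have sum: "(\<Sum>i\<in>UNIV. s i) \<le> 1" using that in_polar_orthogonal_hull_iff_svd[OF Y] by simp
    then have "s i \<le> 1" for i using member_le_sum[of i UNIV s] s by force
    \<comment> \<open>the Frobenius norm is at most the nuclear norm here, since \<open>(s i)\<^sup>2 \<le> s i\<close>\<close>
    then have "(norm Y)\<^sup>2 \<le> (\<Sum>i\<in>UNIV. s i)"
      unfolding norm_power2_svd[OF Y] by (intro sum_mono) (simp add: power2_eq_square mult_left_le s)
    then show ?thesis using sum by (simp add: power2_le_imp_le)
  qed
  then have "bounded ?P" unfolding bounded_iff by blast
  moreover have "closed ?P" unfolding P by (intro closed_INT ballI closed_halfspace_le)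
  moreover have "convex ?P" unfolding P by (intro convex_INT convex_halfspace_le)
  moreover have "ball 0 (1 / CARD('n)) \<subseteq> ?P"
  proof
    fix Y :: "real^'n^'n" assume Y: "Y \<in> ball 0 (1 / CARD('n))"
    obtain U s V where svd: "is_svd U s V Y" by (rule singular_value_decomposition)
    have "s i \<le> 1 / CARD('n)" for i using svd_le_norm[OF svd, of i] Y by simp
    then have "(\<Sum>i\<in>UNIV. s i) \<le> (\<Sum>i\<in>(UNIV :: 'n set). 1 / CARD('n))" by (rule sum_mono)
    then show "Y \<in> ?P" by (simp add: in_polar_orthogonal_hull_iff_svd[OF svd])
  qed
  then have "ball 0 (1 / CARD('n)) \<subseteq> interior ?P" by (simp add: interior_maximal)
  then have "interior ?P \<noteq> {}" by fastforce
  ultimately show ?thesis by (simp add: convex_body_def compact_eq_bounded_closed)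
qed


section \<open>The block matrix inequality\<close>

lemma sum_UNIV_sum: "(\<Sum>a\<in>UNIV. f a) = (\<Sum>i\<in>UNIV. f (Inl i)) + (\<Sum>i\<in>UNIV. f (Inr i))"
  for f :: "'n::finite + 'm::finite \<Rightarrow> real"
  by (simp add: sum.Plus flip: UNIV_Plus_UNIV)

text \<open>The quadratic form of the block matrix at \<open>(y, x)\<close> is
  \<open>|y|\<^sup>2 + 2 y \<bullet> (X *v x) + |x|\<^sup>2\<close>. For fixed \<open>x\<close> its minimum, at \<open>y = - (X *v x)\<close>, is
  \<open>|x|\<^sup>2 - |X *v x|\<^sup>2\<close>.\<close>
lemma psd_block_iff_contraction:
  fixes X :: "real^'n^'n"
  shows "psd (block_matrix (mat 1) X (transpose X) (mat 1)) \<longleftrightarrow> (\<forall>x. norm (X *v x) \<le> norm x)"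
proof -
  let ?M = "block_matrix (mat 1) X (transpose X) (mat 1)"
  have sym: "symmetric_on UNIV (\<lambda>i j. ?M $ i $ j)"
    by (auto simp: symmetric_on_def block_matrix_def transpose_def mat_def split: sum.splits)
  have form: "(\<Sum>i\<in>UNIV. \<Sum>j\<in>UNIV. z i * ?M $ i $ j * z j) =
      y \<bullet> y + 2 * (y \<bullet> (X *v x)) + x \<bullet> x"
    if "y = (\<chi> i. z (Inl i))" "x = (\<chi> i. z (Inr i))" for z x y
  proof -
    have d: "(\<Sum>i\<in>UNIV. \<Sum>j\<in>UNIV. w i * mat 1 $ i $ j * w j) = (\<chi> i. w i) \<bullet> (\<chi> i. w i)" for w :: "'n \<Rightarrow> real"
    proof -
      have "w i * mat 1 $ i $ j * w j = (if i = j then w i * w i else 0)" for i j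
        by (simp add: mat_def)
      then show ?thesis by (simp add: inner_vec_def)
    qed
    have "(\<Sum>i\<in>UNIV. \<Sum>j\<in>UNIV. z (Inr i) * X $ j $ i * z (Inl j)) = y \<bullet> (X *v x)"
      using that by (subst sum.swap)
        (simp add: inner_vec_def matrix_vector_mult_def sum_distrib_left mult_ac)
    moreover have "(\<Sum>i\<in>UNIV. \<Sum>j\<in>UNIV. z (Inl i) * X $ i $ j * z (Inr j)) = y \<bullet> (X *v x)"
      using that by (simp add: inner_vec_def matrix_vector_mult_def sum_distrib_left mult_ac)
    ultimately show ?thesis
      using that d[of "\<lambda>i. z (Inl i)"] d[of "\<lambda>i. z (Inr i)"]
      by (simp add: sum_UNIV_sum block_matrix_def transpose_def sum.distrib)
  qed
  show ?thesis
  proof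
    assume psd: "psd ?M"
    show "\<forall>x. norm (X *v x) \<le> norm x"
    proof
      fix x
      let ?z = "case_sum (\<lambda>i. (- (X *v x)) $ i) (\<lambda>i. x $ i)"
      have "0 \<le> (\<Sum>i\<in>UNIV. \<Sum>j\<in>UNIV. ?z i * ?M $ i $ j * ?z j)"
        using psd by (simp add: psd_def psd_on_def)
      also have "\<dots> = x \<bullet> x - (X *v x) \<bullet> (X *v x)"
      proof -
        have "(\<chi> i. (- (X *v x)) $ i) = - (X *v x)" by (rule vec_lambda_eta)
        then show ?thesis by (subst form[OF refl refl]) (simp del: vector_uminus_component)
      qed
      finally show "norm (X *v x) \<le> norm x" by (simp add: norm_le)
    qed
  next
    assume *: "\<forall>x. norm (X *v x) \<le> norm x"
    have "0 \<le> y \<bullet> y + 2 * (y \<bullet> (X *v x)) + x \<bullet> x" for x y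
    proof -
      have "(X *v x) \<bullet> (X *v x) \<le> x \<bullet> x" using * by (simp add: norm_le)
      moreover have "0 \<le> (y + X *v x) \<bullet> (y + X *v x)" by (rule inner_ge_zero)
      ultimately show ?thesis by (simp add: inner_add inner_commute)
    qed
    then show "psd ?M" using sym by (simp add: psd_def psd_on_def form[OF refl refl])
  qed
qed


section \<open>Compound matrices and the Cauchy--Binet formula\<close>

text \<open>The (multiplicative) compound matrix, whose entries are the minors of \<open>A\<close> of order \<open>r\<close>: column
  \<open>J\<close> is the wedge product of the columns of \<open>A\<close> with index in \<open>J\<close>.\<close>
definition compound :: "nat \<Rightarrow> real^'m::{finite,linorder}^'m::{finite,linorder} \<Rightarrow> 'm set \<Rightarrow> 'm set \<Rightarrow> real" where
  "compound r A I J = wedge_coord r (\<lambda>k. column (sorted_list_of_set J ! k) A) I"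

lemma finite_index_sets: "finite (index_sets r :: 'm::finite set set)"
  by (simp add: index_sets_def)

lemma bij_betw_nth_index_set:
  fixes J :: "'m::{finite,linorder} set"
  assumes "J \<in> index_sets r"
  shows "bij_betw ((!) (sorted_list_of_set J)) {..<r} J"
  using assms by (intro bij_betw_nth) (auto simp: index_sets_def)

lemma wedge_coord_eq_0:
  assumes "a < r" "b < r" "a \<noteq> b" "v a = v b"
  shows "wedge_coord r v I = 0"
proof -
  let ?q = "Transposition.transpose a b"
  have "?q permutes {..<r}" using assms by (intro permutes_swap_id) auto
  moreover have "(\<lambda>k. v (?q k)) = v" using assms by (auto simp: fun_eq_iff Transposition.transpose_def)
  ultimately have "wedge_coord r v I = - wedge_coord r v I"
    using wedge_coord_permute[of ?q r v I] assms by (simp add: sign_swap_id)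
  then show ?thesis by simp
qed

text \<open>Multilinearity: every \<open>A *v v k\<close> is the combination of the columns of \<open>A\<close> with the entries of
  \<open>v k\<close> as coefficients, and \<open>f\<close> chooses a column for each factor.\<close>
lemma wedge_coord_mult_expand:
  fixes A :: "real^'m::{finite,linorder}^'m::{finite,linorder}"
  shows "wedge_coord r (\<lambda>k. A *v v k) I =
    (\<Sum>f\<in>{..<r} \<rightarrow>\<^sub>E UNIV. (\<Prod>k<r. v k $ f k) * wedge_coord r (\<lambda>k. column (f k) A) I)"
proof -
  let ?s = "\<lambda>k. sorted_list_of_set I ! k"
  let ?F = "{..<r} \<rightarrow>\<^sub>E (UNIV :: 'm set)"
  have "(\<Prod>k<r. (A *v v k) $ ?s (p k)) =
      (\<Sum>f\<in>?F. (\<Prod>k<r. v k $ f k) * (\<Prod>k<r. column (f k) A $ ?s (p k)))" for p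
  proof -
    have "(\<Prod>k<r. (A *v v k) $ ?s (p k)) = (\<Prod>k<r. \<Sum>i\<in>UNIV. v k $ i * column i A $ ?s (p k))"
      by (simp add: matrix_vector_mult_def column_def mult.commute)
    also have "\<dots> = (\<Sum>f\<in>?F. \<Prod>k<r. v k $ f k * column (f k) A $ ?s (p k))"
      by (rule prod_sum_PiE) simp_all
    finally show ?thesis by (simp add: prod.distrib)
  qed
  then show ?thesis
    unfolding wedge_coord_def by (simp only: sum_distrib_left) (subst sum.swap, simp add: mult_ac)
qed

text \<open>The Cauchy--Binet formula, in the form that \<open>compound r A\<close> represents the map
  \<open>v\<^sub>1 \<and> \<dots> \<and> v\<^sub>r \<mapsto> A v\<^sub>1 \<and> \<dots> \<and> A v\<^sub>r\<close>. In the multilinear expansion the choices \<open>f\<close> with a repeated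
  column contribute nothing, and an injective choice is an index set together with a permutation,
  whose sign turns the product of entries of the \<open>v\<^sub>k\<close> into a minor.\<close>
lemma wedge_coord_mult:
  fixes A :: "real^'m::{finite,linorder}^'m::{finite,linorder}"
  shows "wedge_coord r (\<lambda>k. A *v v k) I = (\<Sum>J\<in>index_sets r. compound r A I J * wedge_coord r v J)"
proof -
  let ?F = "{..<r} \<rightarrow>\<^sub>E (UNIV :: 'm set)" and ?P = "{p. p permutes {..<r}}"
  let ?D = "\<lambda>f. wedge_coord r (\<lambda>k. column (f k) A) I"
  let ?G = "{f \<in> ?F. inj_on f {..<r}}"
  let ?h = "\<lambda>(J, p). \<lambda>k\<in>{..<r}. sorted_list_of_set J ! p k"
  have fin: "finite ?F" by (intro finite_PiE) auto
  have D: "?D (?h (J, p)) = of_int (sign p) * compound r A I J" if "p \<in> ?P" for J p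
  proof -
    have "?D (?h (J, p)) = wedge_coord r (\<lambda>k. column (sorted_list_of_set J ! p k) A) I"
      by (rule wedge_coord_cong) simp
    then show ?thesis
      using that wedge_coord_permute[of p r "\<lambda>k. column (sorted_list_of_set J ! k) A" I]
      by (simp add: compound_def)
  qed
  have "wedge_coord r (\<lambda>k. A *v v k) I = (\<Sum>f\<in>?F. (\<Prod>k<r. v k $ f k) * ?D f)"
    by (rule wedge_coord_mult_expand)
  also have "\<dots> = (\<Sum>f\<in>?G. (\<Prod>k<r. v k $ f k) * ?D f)"
  proof (rule sum.mono_neutral_right[OF fin])
    show "\<forall>f\<in>?F - ?G. (\<Prod>k<r. v k $ f k) * ?D f = 0"
    proof
      fix f assume "f \<in> ?F - ?G"
      then obtain a b where "a < r" "b < r" "a \<noteq> b" "f a = f b" by (auto simp: inj_on_def)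
      then have "?D f = 0" by (intro wedge_coord_eq_0[of a r b]) auto
      then show "(\<Prod>k<r. v k $ f k) * ?D f = 0" by simp
    qed
  qed auto
  also have "\<dots> = (\<Sum>x\<in>index_sets r \<times> ?P. (\<Prod>k<r. v k $ ?h x k) * ?D (?h x))"
    by (rule sum.reindex_bij_betw[OF injective_family_bij, symmetric])
  also have "\<dots> = (\<Sum>J\<in>index_sets r. \<Sum>p\<in>?P. (\<Prod>k<r. v k $ ?h (J, p) k) * ?D (?h (J, p)))"
    by (simp only: sum.cartesian_product) (rule sum.cong, auto)
  also have "\<dots> = (\<Sum>J\<in>index_sets r. compound r A I J * wedge_coord r v J)"
    unfolding wedge_coord_def[of r v] sum_distrib_left
    by (intro sum.cong refl) (subst D, simp_all)
  finally show ?thesis .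
qed

lemma compound_mult:
  "compound r (A ** B) I J = (\<Sum>K\<in>index_sets r. compound r A I K * compound r B K J)"
proof -
  have "column j (A ** B) = A *v column j B" for j
    by (simp add: column_def matrix_vector_mult_def matrix_matrix_mult_def vec_eq_iff)
  then show ?thesis
    unfolding compound_def[of r "A ** B"] by (simp add: wedge_coord_mult) (simp add: compound_def)
qed

lemma compound_mat_1:
  fixes I J :: "'m::{finite,linorder} set"
  assumes "I \<in> index_sets r" "J \<in> index_sets r"
  shows "compound r (mat 1) I J = (if I = J then 1 else 0)"
proof -
  have "column j (mat 1) = (axis j 1 :: real^'m::{finite,linorder})" for j
    by (auto simp: column_def mat_def axis_def vec_eq_iff)
  then have "compound r (mat 1) I J = wedge_coord r (basis_family J) I"
    by (simp add: compound_def basis_family_def[abs_def])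
  then show ?thesis by (simp add: wedge_coord_basis_family[OF assms])
qed

lemma compound_transpose: "compound r (transpose A) I J = compound r A J I"
proof -
  let ?s = "\<lambda>K k. sorted_list_of_set K ! k"
  have prd: "(\<Prod>k<r. A $ ?s J k $ ?s I (inv p k)) = (\<Prod>k<r. A $ ?s J (p k) $ ?s I k)"
    if p: "p permutes {..<r}" for p
    using prod.permute[OF p, of "\<lambda>k. A $ ?s J k $ ?s I (inv p k)"]
    by (simp add: o_def permutes_inverses[OF p])
  have perm: "permutation p" if "p permutes {..<r}" for p :: "nat \<Rightarrow> nat"
    using that permutation_permutes by blast
  have "compound r (transpose A) I J =
      (\<Sum>p | p permutes {..<r}. of_int (sign p) * (\<Prod>k<r. A $ ?s J k $ ?s I (p k)))"
    by (simp add: compound_def wedge_coord_def column_def transpose_def)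
  also have "\<dots> = (\<Sum>p | p permutes {..<r}. of_int (sign (inv p)) * (\<Prod>k<r. A $ ?s J k $ ?s I (inv p k)))"
    by (rule sum_permutations_inverse)
  also have "\<dots> = compound r A J I"
    unfolding compound_def wedge_coord_def
    by (intro sum.cong refl) (simp add: prd perm sign_inverse column_def)
  finally show ?thesis .
qed

text \<open>The compound is multiplicative and respects transposition, so the compound of an orthogonal
  matrix is orthogonal: its columns, the wedge products of an orthonormal basis, form an orthonormal
  basis of the exterior power.\<close>
lemma compound_orthogonal:
  assumes W: "orthogonal_matrix W" and "I \<in> index_sets r" "J \<in> index_sets r"
  shows "(\<Sum>K\<in>index_sets r. compound r W I K * compound r W J K) = (if I = J then 1 else 0)"
    and "(\<Sum>K\<in>index_sets r. compound r W K I * compound r W K J) = (if I = J then 1 else 0)"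
proof -
  show "(\<Sum>K\<in>index_sets r. compound r W I K * compound r W J K) = (if I = J then 1 else 0)"
    using compound_mult[of r W "transpose W" I J] compound_mat_1[OF assms(2,3)]
    by (simp add: orthogonal_matrix_mults[OF W] compound_transpose)
  show "(\<Sum>K\<in>index_sets r. compound r W K I * compound r W K J) = (if I = J then 1 else 0)"
    using compound_mult[of r "transpose W" W I J] compound_mat_1[OF assms(2,3)]
    by (simp add: orthogonal_matrix_mults[OF W] compound_transpose)
qed


section \<open>Spectrum of the additive compound\<close>

lemma wedge_coord_scale:
  assumes "k < r"
  shows "wedge_coord r (v(k := c *\<^sub>R v k)) I = c * wedge_coord r v I"
proof -
  have "(\<Prod>l<r. (v(k := c *\<^sub>R v k)) l $ e l) = c * (\<Prod>l<r. v l $ e l)" for e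
  proof -
    have "(\<Prod>l<r. (v(k := c *\<^sub>R v k)) l $ e l) = (\<Prod>l<r. (if l = k then c else 1) * v l $ e l)"
      by (intro prod.cong) auto
    then show ?thesis using assms by (simp add: prod.distrib)
  qed
  then show ?thesis by (simp add: wedge_coord_def sum_distrib_left mult_ac)
qed

lemma derivation_coord_eigenvectors:
  assumes "\<And>k. k < r \<Longrightarrow> B *v v k = d k *\<^sub>R v k"
  shows "derivation_coord r B v I = (\<Sum>k<r. d k) * wedge_coord r v I"
  unfolding derivation_coord_def sum_distrib_right
  by (intro sum.cong refl) (simp add: assms wedge_coord_scale)

text \<open>The wedge product of eigenvectors of \<open>B\<close> is an eigenvector of the induced derivation, with the
  sum of the eigenvalues as eigenvalue. Expanding the additive compound in the orthonormal basis of
  wedge products of eigenvectors gives its spectral decomposition.\<close>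
lemma additive_compound_spectral:
  assumes W: "orthogonal_matrix W" and B: "\<And>i. B *v column i W = d i *\<^sub>R column i W"
    and J: "J \<in> index_sets r"
  shows "additive_compound r B I J =
    (\<Sum>K\<in>index_sets r. (\<Sum>k\<in>K. d k) * compound r W I K * compound r W J K)"
proof -
  let ?L = "additive_compound r B" and ?c = "compound r W"
  have eig: "(\<Sum>J'\<in>index_sets r. ?L I J' * ?c J' K) = (\<Sum>k\<in>K. d k) * ?c I K"
    if K: "K \<in> index_sets r" for K
  proof -
    let ?v = "\<lambda>k. column (sorted_list_of_set K ! k) W"
    have "(\<Sum>J'\<in>index_sets r. ?L I J' * ?c J' K) = derivation_coord r B ?v I"
      by (simp add: derivation_coord_additive_compound compound_def)
    also have "\<dots> = (\<Sum>k<r. d (sorted_list_of_set K ! k)) * ?c I K"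
      by (simp add: compound_def derivation_coord_eigenvectors B)
    also have "(\<Sum>k<r. d (sorted_list_of_set K ! k)) = (\<Sum>k\<in>K. d k)"
      by (rule sum.reindex_bij_betw[OF bij_betw_nth_index_set[OF K]])
    finally show ?thesis .
  qed
  have "?L I J = (\<Sum>J'\<in>index_sets r. ?L I J' * (if J' = J then 1 else 0))"
    using J by (simp add: finite_index_sets if_distrib[of "(*) _"] cong: if_cong)
  also have "\<dots> = (\<Sum>J'\<in>index_sets r. ?L I J' * (\<Sum>K\<in>index_sets r. ?c J' K * ?c J K))"
    using compound_orthogonal(1)[OF W _ J] by (intro sum.cong refl) simp
  also have "\<dots> = (\<Sum>K\<in>index_sets r. (\<Sum>J'\<in>index_sets r. ?L I J' * ?c J' K) * ?c J K)"
    unfolding sum_distrib_left sum_distrib_right by (subst sum.swap) (simp add: mult_ac)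
  also have "\<dots> = (\<Sum>K\<in>index_sets r. (\<Sum>k\<in>K. d k) * ?c I K * ?c J K)"
    by (intro sum.cong refl) (simp add: eig)
  finally show ?thesis .
qed

lemma symmetric_additive_compound_spectral:
  assumes "orthogonal_matrix W" "\<And>i. B *v column i W = d i *\<^sub>R column i W"
  shows "symmetric_on (index_sets r) (additive_compound r B)"
  unfolding symmetric_on_def by (simp add: additive_compound_spectral[OF assms] mult_ac)

lemma psd_id_minus_additive_compound_iff:
  fixes W :: "real^'m::{finite,linorder}^'m::{finite,linorder}"
  assumes W: "orthogonal_matrix W" and B: "\<And>i. B *v column i W = d i *\<^sub>R column i W"
  shows "psd_on (index_sets r) (\<lambda>I J. (if I = J then 1 else 0) - additive_compound r B I J) \<longleftrightarrow>
    (\<forall>K\<in>index_sets r. (\<Sum>k\<in>K. d k) \<le> 1)"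
proof -
  let ?S = "index_sets r :: 'm set set" and ?c = "compound r W"
  let ?M = "\<lambda>I J. (if I = J then 1 else 0) - additive_compound r B I J"
  have sym: "symmetric_on ?S ?M"
    using symmetric_additive_compound_spectral[OF W B] by (auto simp: symmetric_on_def)
  have M: "?M I J = (\<Sum>K\<in>?S. (1 - (\<Sum>k\<in>K. d k)) * (?c I K * ?c J K))" if "I \<in> ?S" "J \<in> ?S" for I J
    unfolding additive_compound_spectral[OF W B that(2)] compound_orthogonal(1)[OF W that, symmetric]
    by (simp add: sum_subtractf algebra_simps)
  have form: "(\<Sum>I\<in>?S. \<Sum>J\<in>?S. x I * ?M I J * x J) =
      (\<Sum>K\<in>?S. (1 - (\<Sum>k\<in>K. d k)) * (\<Sum>I\<in>?S. x I * ?c I K)\<^sup>2)" for x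
  proof -
    have "(\<Sum>I\<in>?S. \<Sum>J\<in>?S. x I * ?M I J * x J) =
        (\<Sum>I\<in>?S. \<Sum>J\<in>?S. \<Sum>K\<in>?S. (1 - (\<Sum>k\<in>K. d k)) * ((x I * ?c I K) * (x J * ?c J K)))"
      by (intro sum.cong refl) (simp add: M sum_distrib_left sum_distrib_right mult_ac)
    also have "\<dots> = (\<Sum>K\<in>?S. \<Sum>I\<in>?S. \<Sum>J\<in>?S. (1 - (\<Sum>k\<in>K. d k)) * ((x I * ?c I K) * (x J * ?c J K)))"
      by (subst (2) sum.swap, subst sum.swap) (rule refl)
    also have "\<dots> = (\<Sum>K\<in>?S. (1 - (\<Sum>k\<in>K. d k)) * (\<Sum>I\<in>?S. x I * ?c I K)\<^sup>2)"
      unfolding power2_eq_square sum_product by (simp only: sum_distrib_left)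
    finally show ?thesis .
  qed
  show ?thesis
  proof
    assume psd: "psd_on ?S ?M"
    show "\<forall>K\<in>?S. (\<Sum>k\<in>K. d k) \<le> 1"
    proof
      fix K assume K: "K \<in> ?S"
      \<comment> \<open>evaluate the form at the eigenvector of index \<open>K\<close>\<close>
      have "0 \<le> (\<Sum>I\<in>?S. \<Sum>J\<in>?S. ?c I K * ?M I J * ?c J K)"
        using conjunct2[OF psd[unfolded psd_on_def], rule_format, of "\<lambda>I. ?c I K"] .
      also have "\<dots> = (\<Sum>K'\<in>?S. if K' = K then 1 - (\<Sum>k\<in>K. d k) else 0)"
        unfolding form by (intro sum.cong refl) (simp add: compound_orthogonal(2)[OF W K])
      finally show "(\<Sum>k\<in>K. d k) \<le> 1" using K by (simp add: finite_index_sets)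
    qed
  next
    assume "\<forall>K\<in>?S. (\<Sum>k\<in>K. d k) \<le> 1"
    then show "psd_on ?S ?M"
      unfolding psd_on_def form using sym by (auto intro!: sum_nonneg mult_nonneg_nonneg)
  qed
qed

lemma linear_wedge_coord_slot:
  assumes "k < r"
  shows "linear (\<lambda>x. wedge_coord r (v(k := x)) I)"
proof -
  have "wedge_coord r (v(k := x)) I = (\<Sum>p | p permutes {..<r}. of_int (sign p) *
      (x $ (sorted_list_of_set I ! p k) * (\<Prod>l\<in>{..<r} - {k}. v l $ (sorted_list_of_set I ! p l))))" for x
    using assms unfolding wedge_coord_def by (simp add: prod.remove[of "{..<r}" k])
  then show ?thesis
    by (intro linearI) (simp_all add: algebra_simps sum.distrib sum_distrib_left)
qed

lemma linear_additive_compound: "linear (\<lambda>B. additive_compound r B I J)"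
  unfolding additive_compound_def derivation_coord_def
proof (intro linear_compose_sum ballI)
  fix k assume k: "k \<in> {..<r}"
  let ?v = "basis_family J"
  have "linear (\<lambda>B. B *v ?v k)"
    by (intro linearI) (simp_all add: matrix_vector_mult_add_rdistrib scaleR_matrix_vector_assoc)
  then show "linear (\<lambda>B. wedge_coord r (?v(k := B *v ?v k)) I)"
    using linear_compose[OF _ linear_wedge_coord_slot[of k r ?v I]] k by (simp add: o_def)
qed


section \<open>Eigenvectors of the symmetric dilation\<close>

lemma block_matrix_mult:
  fixes A :: "real^'n^'m" and B :: "real^'q^'m" and C :: "real^'n^'p" and D :: "real^'q^'p"
  shows "block_matrix A B C D ** block_matrix A' B' C' D' =
    block_matrix (A ** A' + B ** C') (A ** B' + B ** D') (C ** A' + D ** C') (C ** B' + D ** D')"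
  by (simp add: vec_eq_iff block_matrix_def matrix_matrix_mult_def sum_UNIV_sum split: sum.split)

lemma transpose_block_matrix:
  "transpose (block_matrix A B C D) =
    block_matrix (transpose A) (transpose C) (transpose B) (transpose D)"
  by (simp add: vec_eq_iff block_matrix_def transpose_def split: sum.split)

lemma block_matrix_mat_1: "block_matrix (mat 1) 0 0 (mat 1) = mat 1"
  by (auto simp: vec_eq_iff block_matrix_def mat_def split: sum.split)

text \<open>The columns are \<open>(u\<^sub>i, v\<^sub>i) / \<surd>2\<close> and \<open>(u\<^sub>i, -v\<^sub>i) / \<surd>2\<close>. If \<open>u\<^sub>i\<close>, \<open>v\<^sub>i\<close> are the singular vectors of
  \<open>X\<close> for \<open>s\<^sub>i\<close>, these are eigenvectors of \<open>sym_dilation X\<close> for \<open>s\<^sub>i\<close> and \<open>-s\<^sub>i\<close>.\<close>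
definition dilation_eigenvectors :: "real^'n^'n \<Rightarrow> real^'n^'n \<Rightarrow> real^('n + 'n)^('n + 'n)" where
  "dilation_eigenvectors U V = (1 / sqrt 2) *\<^sub>R block_matrix U U V (- V)"

lemma orthogonal_dilation_eigenvectors:
  fixes U :: "real^'n^'n"
  assumes U: "orthogonal_matrix U" and V: "orthogonal_matrix V"
  shows "orthogonal_matrix (dilation_eigenvectors U V)"
proof -
  let ?M = "block_matrix U U V (- V)"
  have neg: "transpose (- V) = - transpose V" "A ** (- V) = - (A ** V)" "(- transpose V) ** A = - (transpose V ** A)" for A
    by (simp_all add: vec_eq_iff transpose_def matrix_matrix_mult_def sum_negf)
  have "transpose ?M ** ?M = block_matrix (mat 1 + mat 1) 0 0 (mat 1 + mat 1)"
    by (simp add: transpose_block_matrix block_matrix_mult neg orthogonal_matrix_mults[OF U] orthogonal_matrix_mults[OF V])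
  also have "\<dots> = 2 *\<^sub>R block_matrix (mat 1) 0 0 (mat 1)"
    by (auto simp: vec_eq_iff block_matrix_def mat_def split: sum.split)
  finally have "transpose ?M ** ?M = 2 *\<^sub>R mat 1" by (simp only: block_matrix_mat_1)
  moreover have "transpose ((1 / sqrt 2) *\<^sub>R ?M) = (1 / sqrt 2) *\<^sub>R transpose ?M"
    by (simp add: vec_eq_iff transpose_def)
  ultimately show ?thesis
    unfolding orthogonal_matrix dilation_eigenvectors_def
    by (simp add: matrix_scalar_ac flip: scalar_matrix_assoc)
qed

lemma dilation_eigenvectors:
  fixes X :: "real^'n^'n"
  assumes X: "is_svd U s V X"
  shows "sym_dilation X *v column a (dilation_eigenvectors U V) =
    case_sum s (\<lambda>i. - s i) a *\<^sub>R column a (dilation_eigenvectors U V)"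
proof -
  have *: "(sym_dilation X *v column a (dilation_eigenvectors U V)) $ c =
      (case c of
        Inl i \<Rightarrow> (1 / sqrt 2) * (case a of Inl j \<Rightarrow> (X *v column j V) $ i | Inr j \<Rightarrow> - (X *v column j V) $ i)
      | Inr i \<Rightarrow> (1 / sqrt 2) * (case a of Inl j \<Rightarrow> (transpose X *v column j U) $ i
          | Inr j \<Rightarrow> (transpose X *v column j U) $ i))" for c
    by (cases a; cases c)
      (simp_all add: sym_dilation_def dilation_eigenvectors_def block_matrix_def column_def
        matrix_vector_mult_def sum_UNIV_sum sum_distrib_left sum_negf)
  show ?thesis
    unfolding vec_eq_iff * svd_mult_columns[OF X]
    by (auto simp: dilation_eigenvectors_def block_matrix_def column_def split: sum.split)
qed

text \<open>Among the sums of \<open>n\<close> of the \<open>2n\<close> numbers \<open>\<plusminus>s\<^sub>i\<close>, the largest takes \<open>+s\<^sub>i\<close> for every \<open>i\<close>.\<close>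
lemma sum_over_index_sets_le_1_iff:
  fixes s :: "'n::finite \<Rightarrow> real"
  assumes s: "\<And>i. 0 \<le> s i"
  shows "(\<forall>K\<in>index_sets CARD('n). (\<Sum>k\<in>K. case_sum s (\<lambda>i. - s i) k) \<le> 1) \<longleftrightarrow> (\<Sum>i\<in>UNIV. s i) \<le> 1"
    (is "(\<forall>K\<in>_. sum ?d K \<le> 1) \<longleftrightarrow> _")
proof
  assume *: "\<forall>K\<in>index_sets CARD('n). sum ?d K \<le> 1"
  have "range (Inl :: 'n \<Rightarrow> 'n + 'n) \<in> index_sets CARD('n)"
    by (simp add: index_sets_def card_image)
  then have "sum ?d (range Inl) \<le> 1" using * by blast
  then show "(\<Sum>i\<in>UNIV. s i) \<le> 1" by (simp add: sum.reindex)
next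
  assume *: "(\<Sum>i\<in>UNIV. s i) \<le> 1"
  show "\<forall>K\<in>index_sets CARD('n). sum ?d K \<le> 1"
  proof
    fix K :: "('n + 'n) set"
    have "sum ?d K \<le> sum (\<lambda>k. max 0 (?d k)) K" by (intro sum_mono) simp
    also have "\<dots> \<le> sum (\<lambda>k. max 0 (?d k)) UNIV" by (intro sum_mono2) auto
    also have "\<dots> = (\<Sum>i\<in>UNIV. s i)" by (simp add: sum_UNIV_sum s)
    finally show "sum ?d K \<le> 1" using * by simp
  qed
qed

lemma symmetric_additive_compound_dilation:
  fixes X :: "real^'n::{finite,linorder}^'n::{finite,linorder}"
  shows "symmetric_on (index_sets r) (additive_compound r (sym_dilation X))"
proof -
  obtain U s V where X: "is_svd U s V X" by (rule singular_value_decomposition)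
  then have "orthogonal_matrix (dilation_eigenvectors U V)"
    by (simp add: is_svd_def orthogonal_dilation_eigenvectors)
  then show ?thesis using dilation_eigenvectors[OF X] by (rule symmetric_additive_compound_spectral)
qed

lemma psd_additive_compound_dilation_iff_svd:
  fixes X :: "real^'n::{finite,linorder}^'n::{finite,linorder}"
  assumes X: "is_svd U s V X"
  shows "psd_on (index_sets CARD('n))
      (\<lambda>I J. (if I = J then 1 else 0) - additive_compound CARD('n) (sym_dilation X) I J) \<longleftrightarrow>
    (\<Sum>i\<in>UNIV. s i) \<le> 1"
proof -
  have "orthogonal_matrix (dilation_eigenvectors U V)"
    using X by (simp add: is_svd_def orthogonal_dilation_eigenvectors)
  then show ?thesis
    using psd_id_minus_additive_compound_iff[OF _ dilation_eigenvectors[OF X]]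
      sum_over_index_sets_le_1_iff[of s] X by (simp add: is_svd_def)
qed


section \<open>Linear matrix inequalities and spectrahedra\<close>

lemma psd_on_reindex:
  assumes g: "bij_betw g T S"
  shows "psd_on S M \<longleftrightarrow> psd_on T (\<lambda>i j. M (g i) (g j))"
proof -
  have sym: "symmetric_on S M \<longleftrightarrow> symmetric_on T (\<lambda>i j. M (g i) (g j))"
    using g unfolding symmetric_on_def bij_betw_def by blast
  have form: "(\<Sum>i\<in>S. \<Sum>j\<in>S. x i * M i j * x j) =
      (\<Sum>i\<in>T. \<Sum>j\<in>T. x (g i) * M (g i) (g j) * x (g j))" for x
    by (simp add: sum.reindex_bij_betw[OF g, symmetric])
  have inv: "(\<Sum>i\<in>T. \<Sum>j\<in>T. y i * M (g i) (g j) * y j) =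
      (\<Sum>i\<in>T. \<Sum>j\<in>T. (y \<circ> inv_into T g) (g i) * M (g i) (g j) * (y \<circ> inv_into T g) (g j))" for y
    using g by (intro sum.cong refl) (simp add: bij_betw_inv_into_left)
  show ?thesis
    unfolding psd_on_def sym form
  proof (intro conj_cong refl iffI allI)
    fix y
    assume *: "\<forall>x. 0 \<le> (\<Sum>i\<in>T. \<Sum>j\<in>T. x (g i) * M (g i) (g j) * x (g j))"
    show "0 \<le> (\<Sum>i\<in>T. \<Sum>j\<in>T. y i * M (g i) (g j) * y j)"
      using spec[OF *, of "y \<circ> inv_into T g"] by (subst inv)
  next
    fix x
    assume *: "\<forall>y. 0 \<le> (\<Sum>i\<in>T. \<Sum>j\<in>T. y i * M (g i) (g j) * y j)"
    show "0 \<le> (\<Sum>i\<in>T. \<Sum>j\<in>T. x (g i) * M (g i) (g j) * x (g j))"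
      using spec[OF *, of "\<lambda>i. x (g i)"] .
  qed
qed

text \<open>A linear matrix inequality may be indexed by any finite set and have its linear part given as
  a linear map instead of by coefficient matrices: enumerate the index set, and take as coefficients
  the values of the linear map on the basis.\<close>
lemma spectrahedronI:
  fixes L :: "'a::euclidean_space \<Rightarrow> 'i \<Rightarrow> 'i \<Rightarrow> real"
  assumes S: "finite S" and M0: "symmetric_on S M0"
    and L: "\<And>i j. linear (\<lambda>x. L x i j)" and sym: "\<And>x. symmetric_on S (L x)"
  shows "spectrahedron {x. psd_on S (\<lambda>i j. M0 i j + L x i j)}"
proof -
  obtain g where g: "bij_betw g {..<card S} S"
    using ex_bij_betw_nat_finite[OF S] by (auto simp: atLeast0LessThan)
  have gS: "g i \<in> S" if "i < card S" for i using that g by (auto simp: bij_betw_def)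
  have expand: "L x i j = (\<Sum>b\<in>Basis. (x \<bullet> b) * L b i j)" for x i j
  proof -
    have "L x i j = L (\<Sum>b\<in>Basis. (x \<bullet> b) *\<^sub>R b) i j" by (simp add: euclidean_representation)
    also have "\<dots> = (\<Sum>b\<in>Basis. (x \<bullet> b) * L b i j)"
      by (simp add: linear_sum[OF L] linear_scale[OF L])
    finally show ?thesis .
  qed
  show ?thesis unfolding spectrahedron_def
  proof (intro exI conjI)
    show "symmetric_on {..<card S} (\<lambda>i j. M0 (g i) (g j))"
      using M0 gS by (simp add: symmetric_on_def)
    show "\<forall>b\<in>Basis. symmetric_on {..<card S} (\<lambda>i j. L b (g i) (g j))"
      using sym gS by (simp add: symmetric_on_def)
    show "{x. psd_on S (\<lambda>i j. M0 i j + L x i j)} = {x. psd_on {..<card S}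
        (\<lambda>i j. M0 (g i) (g j) + (\<Sum>b\<in>Basis. (x \<bullet> b) * L b (g i) (g j)))}"
      unfolding psd_on_reindex[OF g] expand[symmetric] ..
  qed
qed

lemma linear_sym_dilation: "linear sym_dilation"
  by (intro linearI)
    (simp_all add: sym_dilation_def block_matrix_def transpose_def vec_eq_iff split: sum.split)

text \<open>The block matrix is the identity plus \<open>sym_dilation X\<close>, which is linear in \<open>X\<close>.\<close>
lemma spectrahedron_orthogonal_hull:
  "spectrahedron (convex hull orthogonal_group :: (real^'n^'n) set)"
proof -
  have block: "block_matrix (mat 1) X (transpose X) (mat 1) $ i $ j =
      (mat 1 :: real^('n + 'n)^('n + 'n)) $ i $ j + sym_dilation X $ i $ j"
    for X :: "real^'n^'n" and i j
    by (simp add: sym_dilation_def block_matrix_def mat_def split: sum.split)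
  have "linear (\<lambda>X. sym_dilation X $ i $ j :: real)" for i j :: "'n + 'n"
    by (intro linearI) (simp_all add: linear_add[OF linear_sym_dilation] linear_scale[OF linear_sym_dilation])
  then have "spectrahedron {X :: real^'n^'n. psd_on UNIV (\<lambda>i j. (mat 1 :: real^('n + 'n)^('n + 'n)) $ i $ j + sym_dilation X $ i $ j)}"
    by (intro spectrahedronI)
      (auto simp: symmetric_on_def sym_dilation_def block_matrix_def mat_def transpose_def split: sum.split)
  also have "{X :: real^'n^'n. psd_on UNIV (\<lambda>i j. (mat 1 :: real^('n + 'n)^('n + 'n)) $ i $ j + sym_dilation X $ i $ j)} =
      convex hull orthogonal_group"
    unfolding set_eq_iff mem_Collect_eq in_orthogonal_hull_iff_contraction
      psd_block_iff_contraction[symmetric] psd_def block by simp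
  finally show ?thesis .
qed

lemma in_polar_orthogonal_hull_iff_psd:
  fixes X :: "real^'n::{finite,linorder}^'n::{finite,linorder}"
  shows "X \<in> polar_body (convex hull orthogonal_group) \<longleftrightarrow>
    psd_on (index_sets CARD('n))
      (\<lambda>I J. (if I = J then 1 else 0) - additive_compound CARD('n) (sym_dilation X) I J)"
proof -
  obtain U s V where X: "is_svd U s V X" by (rule singular_value_decomposition)
  show ?thesis
    by (simp add: in_polar_orthogonal_hull_iff_svd[OF X] psd_additive_compound_dilation_iff_svd[OF X])
qed

lemma spectrahedron_polar_orthogonal_hull:
  "spectrahedron (polar_body (convex hull orthogonal_group :: (real^'n::{finite,linorder}^'n::{finite,linorder}) set))"
proof -
  let ?L = "\<lambda>X :: real^'n::{finite,linorder}^'n::{finite,linorder}. \<lambda>I J. - additive_compound CARD('n) (sym_dilation X) I J"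
  have sym: "symmetric_on (index_sets CARD('n)) (?L X)" for X
    using symmetric_additive_compound_dilation[of "CARD('n)" X] by (simp add: symmetric_on_def)
  have lin: "linear (\<lambda>X. ?L X I J)" for I J
    using linear_compose[OF linear_sym_dilation linear_additive_compound]
    by (intro linear_compose_neg) (simp add: o_def)
  have "spectrahedron {X. psd_on (index_sets CARD('n)) (\<lambda>I J. (if I = J then 1 else 0) + ?L X I J)}"
    by (intro spectrahedronI finite_index_sets lin sym) (simp add: symmetric_on_def)
  also have "{X. psd_on (index_sets CARD('n)) (\<lambda>I J. (if I = J then 1 else 0) + ?L X I J)} =
      polar_body (convex hull orthogonal_group)"
    by (auto simp: in_polar_orthogonal_hull_iff_psd)
  finally show ?thesis .
qed


section \<open>The orbitope and coorbitope of the orthogonal group\<close>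

theorem corollary4p9:
  shows "let C = convex hull orthogonal_group :: (real^'n::{finite,linorder}^'n::{finite,linorder}) set in
    {X. singular_value 1 X \<le> 1} = C \<and>
    polar_body C = {X. (\<Sum>i = 1..CARD('n). singular_value i X) \<le> 1} \<and>
    convex_body C \<and> convex_body (polar_body C) \<and>
    spectrahedron C \<and> spectrahedron (polar_body C) \<and>
    (\<forall>X. X \<in> C \<longleftrightarrow>
      psd (block_matrix (mat 1) X (transpose X) (mat 1))) \<and>
    (\<forall>X. X \<in> polar_body C \<longleftrightarrow>
      psd_on (index_sets CARD('n))
        (\<lambda>I J. (if I = J then 1 else 0)
                - additive_compound CARD('n) (sym_dilation X) I J))"
proof -
  let ?C = "convex hull orthogonal_group :: (real^'n::{finite,linorder}^'n::{finite,linorder}) set"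
  have ball: "singular_value 1 X \<le> 1 \<longleftrightarrow> X \<in> ?C"
    and polar: "X \<in> polar_body ?C \<longleftrightarrow> (\<Sum>i = 1..CARD('n). singular_value i X) \<le> 1" for X
  proof -
    obtain U s V where X: "is_svd U s V X" by (rule singular_value_decomposition)
    show "singular_value 1 X \<le> 1 \<longleftrightarrow> X \<in> ?C"
      by (simp only: singular_value_1_le_svd[OF X] in_orthogonal_hull_iff_svd[OF X])
    show "X \<in> polar_body ?C \<longleftrightarrow> (\<Sum>i = 1..CARD('n). singular_value i X) \<le> 1"
      by (simp only: sum_singular_values_svd[OF X] in_polar_orthogonal_hull_iff_svd[OF X])
  qed
  have block: "X \<in> ?C \<longleftrightarrow> psd (block_matrix (mat 1) X (transpose X) (mat 1))" for X
    by (simp only: in_orthogonal_hull_iff_contraction psd_block_iff_contraction)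
  show ?thesis
    unfolding Let_def
  proof (intro conjI allI)
    show "{X. singular_value 1 X \<le> 1} = ?C" using ball by blast
    show "polar_body ?C = {X. (\<Sum>i = 1..CARD('n). singular_value i X) \<le> 1}" using polar by blast
  qed (rule convex_body_orthogonal_hull convex_body_polar_orthogonal_hull
      spectrahedron_orthogonal_hull spectrahedron_polar_orthogonal_hull
      block in_polar_orthogonal_hull_iff_psd)+
qed

end
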